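(* Let $h$ be a Bernstein function that is not identically zero. Then there are a LICM function $f_0$ on $]0,\infty[$ and a real number $b\ge 0$ such that, with $f = b\,u + f_0$ (so that $\tilde f(p) = b+\tilde f_0(p)$ for $p>0$), $$\frac{1}{p\,\tilde h(p)} = p\,\tilde f(p)\quad\text{for all } p>0,$$ and the following hold: (i) The function $h(t)$ is either bounded and tends to a positive limit as $t\to\infty$, or it diverges to infinity as $t\to\infty$. In the first case $\lim_{t\to\infty} f_0(t) = \lim_{t\to\infty} 1/h(t)$; otherwise $f_0(t)\to 0$ as $t\to\infty$. (ii) If $h(0)>0$, then $f_0$ is bounded at $0$, $f_0(0)=1/h(0)$ and $b=0$; otherwise either $b>0$ or $f_0$ is unbounded at $0$. (iii) If $h(0)=0$, then $b = 1/h'(0)$, where $h'(0) := \lim_{t\to 0+} h'(t)\in[0,\infty]$ and $1/\infty := 0$.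
   Context: Notation: $[0,\infty[ = \{x\in\mathbf{R} : 0\le x<\infty\}$ and $]0,\infty[ = \{x\in\mathbf{R} : 0<x<\infty\}$. LICM (locally integrable completely monotone): an infinitely differentiable function $g$ on $]0,\infty[$ is LICM if $(-1)^n g^{(n)}(t)\ge 0$ for all $t>0$ and $n=0,1,2,\ldots$, and $g$ is integrable in a neighborhood of $0$. For such a function, $g(0)$ denotes $\lim_{t\to 0+} g(t)\in[0,\infty]$, and "$g$ is unbounded at $0$" means $g(0)=\infty$. The zero function is LICM. Bernstein function: a function $h$ continuous on $[0,\infty[$ and infinitely differentiable on $]0,\infty[$ with $h(t)\ge 0$ and $(-1)^n h^{(n)}(t)\le 0$ for all $t>0$ and $n=1,2,\ldots$. Laplace transform: $\tilde g(p) = \int_0^\infty e^{-pt} g(t)\,dt$ for a locally integrable function $g$ whenever it exists; for LICM functions and Bernstein functions it exists for all $p>0$. The symbol $u$ denotes the identity of convolution: $u*g=g$ for every $g\in \mathcal{L}^1_{\mathrm{loc}}([0,\infty[)$, where $(f*g)(t)=\int_0^t f(s)g(t-s)\,ds$. It is identified with the identity operator on $\mathcal{L}^1_{\mathrm{loc}}([0,\infty[)$ and is assigned the Laplace transform $\tilde u(p)=1$. The expression $b\,u+f_0$ is understood as a convolution operator, with Laplace transform $b+\tilde f_0(p)$. *)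

theory Defs
  imports "HOL-Analysis.Analysis"
begin

text \<open>
  Functions on \<open>]0,\<infinity>[\<close> or \<open>[0,\<infinity>[\<close> are total functions \<open>real \<Rightarrow> real\<close> whose values outside that set
  are irrelevant: for \<open>t > 0\<close>, \<open>(deriv ^^ n) g t\<close> only depends on \<open>g\<close> near \<open>t\<close>.
\<close>

definition smooth_pos :: "(real \<Rightarrow> real) \<Rightarrow> bool" where
  "smooth_pos g \<longleftrightarrow> (\<forall>n. \<forall>t>0. (deriv ^^ n) g differentiable (at t))"

definition licm :: "(real \<Rightarrow> real) \<Rightarrow> bool" where
  "licm g \<longleftrightarrow> smooth_pos g \<and>
     (\<forall>n. \<forall>t>0. (-1) ^ n * (deriv ^^ n) g t \<ge> 0) \<and>
     (\<exists>\<epsilon>>0. set_integrable lborel {0<..<\<epsilon>} g)"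

definition bernstein :: "(real \<Rightarrow> real) \<Rightarrow> bool" where
  "bernstein h \<longleftrightarrow> continuous_on {0..} h \<and> smooth_pos h \<and>
     (\<forall>t>0. h t \<ge> 0) \<and>
     (\<forall>n\<ge>1. \<forall>t>0. (-1) ^ n * (deriv ^^ n) h t \<le> 0)"

text \<open>
  \<open>has_value_at_0 g L\<close> renders \<open>g(0) = L\<close> for a function \<open>g\<close> on \<open>]0,\<infinity>[\<close>, where \<open>g(0)\<close> stands for
  the right limit at \<open>0\<close>, possibly infinite. The actual value \<open>g 0\<close> of the total function plays no role.
\<close>

definition has_value_at_0 :: "(real \<Rightarrow> real) \<Rightarrow> ereal \<Rightarrow> bool" where
  "has_value_at_0 g L \<longleftrightarrow> ((\<lambda>t. ereal (g t)) \<longlongrightarrow> L) (at_right 0)"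

definition laplace_exists :: "(real \<Rightarrow> real) \<Rightarrow> real \<Rightarrow> bool" where
  "laplace_exists g p \<longleftrightarrow> set_integrable lborel {0<..} (\<lambda>t. exp (- p * t) * g t)"

definition laplace :: "(real \<Rightarrow> real) \<Rightarrow> real \<Rightarrow> real" where
  "laplace g p = (LINT t:{0<..}|lborel. exp (- p * t) * g t)"

text \<open>
  The Laplace transform assigned to the convolution operator \<open>b u + f\<^sub>0\<close>, that is
  \<open>g \<mapsto> b g + f\<^sub>0 * g\<close>, where \<open>u\<close> is the identity of convolution and has Laplace transform \<open>1\<close>.
\<close>

definition laplace_conv_op :: "real \<Rightarrow> (real \<Rightarrow> real) \<Rightarrow> real \<Rightarrow> real" where
  "laplace_conv_op b f\<^sub>0 p = b * 1 + laplace f\<^sub>0 p"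

end

theory Submission
  imports Defs "HOL-Complex_Analysis.Great_Picard" "HOL-Computational_Algebra.Fundamental_Theorem_Algebra"
begin

text \<open>
Write \<open>g = h'\<close>. Integration by parts gives \<open>p \<cdot> laplace h p = h 0 + laplace g p\<close>, and \<open>g\<close> is completely monotone.
The theorem asks for an \<open>f\<close> whose transform is \<open>1 / (p \<cdot> (h 0 + laplace g p))\<close>. The point is that this
reciprocal is again of the form \<open>b + laplace f\<^sub>0 p\<close> with \<open>f\<^sub>0\<close> completely monotone and \<open>b \<ge> 0\<close>; this is the
classical fact that \<open>1 / (p S(p))\<close> is a Stieltjes function whenever \<open>S\<close> is one and is not zero.

For a finite sum \<open>g(t) = \<Sum> c\<^sub>i exp (- x\<^sub>i t)\<close> with \<open>c\<^sub>i, x\<^sub>i > 0\<close> and a constant \<open>a > 0\<close> in place of \<open>h 0\<close> the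
fact is algebra (\<open>reciprocal_partial_fractions\<close>): \<open>S(z) = a + \<Sum> c\<^sub>i / (z + x\<^sub>i)\<close> is rational, all zeros of \<open>z S(z)\<close> are real,
nonpositive and simple, and the derivative of \<open>z S(z)\<close> is positive there. So the partial fraction
expansion of \<open>1 / (p S(p))\<close> is \<open>\<Sum> d\<^sub>y / (p + y)\<close> with \<open>d\<^sub>y > 0\<close> and \<open>y \<ge> 0\<close>, the Laplace transform of a
sum of decaying exponentials with positive coefficients.

The general case follows by approximation, without an integral representation of \<open>g\<close>. On the one
hand, every completely monotone function is a pointwise limit of finite exponential sums
(\<open>completely_monotone_exponential_sums\<close>): its Taylor series at a large point \<open>A\<close>, evaluated at
\<open>A (1 - exp (- t / A)) \<approx> t\<close>, already is a series in the functions \<open>exp (- k t / A)\<close> with nonnegative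
coefficients. On the other hand, if the transforms of such sums converge pointwise, then by
Montel's theorem a subsequence of the sums converges, together with all its derivatives, to a
completely monotone function; the limit of the transforms exceeds the transform of the limit by a
constant \<open>b \<ge> 0\<close>, the mass that has escaped to the point \<open>0\<close> (\<open>limit_of_exponential_sums\<close>).
Together they give \<open>reciprocal_of_completely_monotone_laplace\<close>.

The statements (i), (ii) and (iii) are Abelian (\<open>laplace_abelian\<close>): as \<open>p\<close> tends to \<open>0\<close> or to infinity,
\<open>p \<cdot> laplace \<phi> p\<close> tends to the limit of \<open>\<phi>\<close> at infinity or at \<open>0\<close>. This is applied to \<open>h\<close>, to \<open>h'\<close> and to
\<open>f\<^sub>0\<close>, and the limits are compared in \<open>1 / (p \<cdot> laplace h p) = p b + p \<cdot> laplace f\<^sub>0 p\<close>.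
\<close>

section \<open>The Laplace transform\<close>

lemma exp_neg_mult_tendsto_0:
  fixes q :: real
  assumes "0 < q"
  shows "((\<lambda>t. exp (- q * t)) \<longlongrightarrow> 0) at_top"
  using assms
  by (intro filterlim_compose[OF exp_at_bot] filterlim_tendsto_neg_mult_at_bot[OF tendsto_const] filterlim_ident)
    auto

lemma laplace_exp:
  fixes p y :: real
  assumes "0 < p + y"
  shows "laplace_exists (\<lambda>t. exp (- y * t)) p" "laplace (\<lambda>t. exp (- y * t)) p = 1 / (p + y)"
proof -
  define q where "q = p + y"
  have q: "0 < q" using assms by (simp add: q_def)
  let ?F = "\<lambda>t. - exp (- q * t) / q"
  have ev: "einterval 0 \<infinity> = {0::real<..}" by (auto simp: einterval_def)
  have der: "(?F has_real_derivative exp (- q * t)) (at t)" for t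
    using q by (auto intro!: derivative_eq_intros)
  have lim0: "((?F \<circ> real_of_ereal) \<longlongrightarrow> - 1 / q) (at_right 0)"
    unfolding zero_ereal_def ereal_tendsto_simps using q
    by (auto intro!: tendsto_eq_intros)
  have "(?F \<longlongrightarrow> - 0 / q) at_top"
    using q by (intro tendsto_divide tendsto_minus tendsto_const exp_neg_mult_tendsto_0) auto
  then have lim1: "((?F \<circ> real_of_ereal) \<longlongrightarrow> 0) (at_left \<infinity>)"
    unfolding ereal_tendsto_simps by simp
  note FTC = interval_integral_FTC_nonneg[of 0 \<infinity> ?F "\<lambda>t. exp (- q * t)", OF _ der _ _ lim0 lim1]
  have eq: "exp (- p * t) * exp (- y * t) = exp (- q * t)" for t
    by (simp add: q_def exp_add[symmetric] algebra_simps)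
  show "laplace_exists (\<lambda>t. exp (- y * t)) p"
    unfolding laplace_exists_def eq using FTC(1) by (simp add: ev)
  have "(LBINT t=0..\<infinity>. exp (- q * t)) = 1 / q"
    using FTC(2) by simp
  then show "laplace (\<lambda>t. exp (- y * t)) p = 1 / (p + y)"
    unfolding laplace_def eq by (simp add: interval_lebesgue_integral_def ev q_def)
qed

lemma laplace_const:
  assumes "0 < p"
  shows "laplace_exists (\<lambda>_. c) p" "laplace (\<lambda>_. c) p = c / p"
  using laplace_exp[of p 0] assms
  by (simp_all add: laplace_exists_def laplace_def)

lemma laplace_sum_exp:
  fixes p :: real and d x :: "'a \<Rightarrow> real"
  assumes "0 < p" "\<And>y. y \<in> J \<Longrightarrow> 0 \<le> x y"
  shows "laplace_exists (\<lambda>t. \<Sum>y\<in>J. d y * exp (- x y * t)) p"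
    and "laplace (\<lambda>t. \<Sum>y\<in>J. d y * exp (- x y * t)) p = (\<Sum>y\<in>J. d y / (p + x y))"
proof -
  have eq: "exp (- p * t) * (\<Sum>y\<in>J. d y * exp (- x y * t)) = (\<Sum>y\<in>J. d y * (exp (- p * t) * exp (- x y * t)))" for t
    by (simp add: sum_distrib_left mult_ac)
  have int: "set_integrable lborel {0<..} (\<lambda>t. d y * (exp (- p * t) * exp (- x y * t)))" if "y \<in> J" for y
    using laplace_exp(1)[of p "x y"] assms that unfolding laplace_exists_def
    by (intro set_integrable_mult_right) (auto intro: add_pos_nonneg)
  show "laplace_exists (\<lambda>t. \<Sum>y\<in>J. d y * exp (- x y * t)) p"
    unfolding laplace_exists_def eq
    using int unfolding set_integrable_def scaleR_sum_right by (rule Bochner_Integration.integrable_sum)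
  have "laplace (\<lambda>t. \<Sum>y\<in>J. d y * exp (- x y * t)) p
      = (\<Sum>y\<in>J. LINT t:{0<..}|lborel. d y * (exp (- p * t) * exp (- x y * t)))"
    unfolding laplace_def eq
    using int unfolding set_integrable_def set_lebesgue_integral_def scaleR_sum_right
    by (rule Bochner_Integration.integral_sum)
  also have "\<dots> = (\<Sum>y\<in>J. d y / (p + x y))"
    using assms laplace_exp(2)[of p "x _"]
    by (intro sum.cong refl) (simp add: laplace_def add_pos_nonneg del: mult_minus_left)
  finally show "laplace (\<lambda>t. \<Sum>y\<in>J. d y * exp (- x y * t)) p = (\<Sum>y\<in>J. d y / (p + x y))" .
qed

lemma laplace_dominated_convergence:
  fixes \<phi> :: "nat \<Rightarrow> real \<Rightarrow> real"
  assumes "\<And>m. laplace_exists (\<phi> m) p" "laplace_exists \<psi> p" "laplace_exists w p"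
    and "\<And>t. 0 < t \<Longrightarrow> (\<lambda>m. \<phi> m t) \<longlonglongrightarrow> \<psi> t"
    and "\<And>m t. 0 < t \<Longrightarrow> \<bar>\<phi> m t\<bar> \<le> w t"
  shows "(\<lambda>m. laplace (\<phi> m) p) \<longlonglongrightarrow> laplace \<psi> p"
  unfolding laplace_def set_lebesgue_integral_def
proof (rule integral_dominated_convergence[where w = "\<lambda>t. indicator {0<..} t *\<^sub>R (exp (- p * t) * w t)"])
  show "AE t in lborel. (\<lambda>m. indicator {0<..} t *\<^sub>R (exp (- p * t) * \<phi> m t))
      \<longlonglongrightarrow> indicator {0<..} t *\<^sub>R (exp (- p * t) * \<psi> t)"
  proof (rule AE_I2)
    fix t :: real
    show "(\<lambda>m. indicator {0<..} t *\<^sub>R (exp (- p * t) * \<phi> m t))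
        \<longlonglongrightarrow> indicator {0<..} t *\<^sub>R (exp (- p * t) * \<psi> t)"
      using assms(4)[of t] by (cases "0 < t") (auto intro!: tendsto_mult_left)
  qed
  show "AE t in lborel. norm (indicator {0<..} t *\<^sub>R (exp (- p * t) * \<phi> m t))
      \<le> indicator {0<..} t *\<^sub>R (exp (- p * t) * w t)" for m
    using assms(5)[of _ m] by (intro AE_I2) (auto simp: indicator_def abs_mult)
qed (use assms(1,2,3) in \<open>auto simp: laplace_exists_def set_integrable_def intro!: borel_measurable_integrable\<close>)

lemma laplace_exists_if_dominated:
  assumes "continuous_on {0<..} \<phi>" "laplace_exists w p" "\<And>t. 0 < t \<Longrightarrow> \<bar>\<phi> t\<bar> \<le> w t"
  shows "laplace_exists \<phi> p"
  unfolding laplace_exists_def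
proof (rule set_integrable_bound[OF assms(2)[unfolded laplace_exists_def]])
  have "(\<lambda>t. indicator {0<..} t *\<^sub>R (exp (- p * t) * \<phi> t)) \<in> borel_measurable borel"
    by (intro borel_measurable_continuous_on_indicator continuous_intros assms) auto
  then show "set_borel_measurable lborel {0<..} (\<lambda>t. exp (- p * t) * \<phi> t)"
    by (simp add: set_borel_measurable_def)
  show "AE t in lborel. t \<in> {0<..} \<longrightarrow> norm (exp (- p * t) * \<phi> t) \<le> norm (exp (- p * t) * w t)"
    using assms(3) by (intro AE_I2) (force simp: abs_mult)
qed

lemma laplace_scale:
  fixes k q :: real
  assumes k: "0 < k" and ex: "laplace_exists \<phi> (q / k)"
  shows "laplace_exists (\<lambda>s. \<phi> (k * s)) q" "laplace (\<lambda>s. \<phi> (k * s)) q = laplace \<phi> (q / k) / k"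
proof -
  define u where "u t = indicator {0<..} t *\<^sub>R (exp (- (q / k) * t) * \<phi> t)" for t
  have eq: "u (0 + k * s) = indicator {0<..} s *\<^sub>R (exp (- q * s) * \<phi> (k * s))" for s
    using k by (simp add: u_def indicator_def zero_less_mult_iff)
  have "integrable lborel u" using ex by (simp add: laplace_exists_def set_integrable_def u_def[abs_def])
  then have "integrable lborel (\<lambda>s. u (0 + k * s))"
    using k by (intro lborel_integrable_real_affine) auto
  then show "laplace_exists (\<lambda>s. \<phi> (k * s)) q"
    unfolding eq by (simp add: laplace_exists_def set_integrable_def)
  have "integral\<^sup>L lborel u = k * integral\<^sup>L lborel (\<lambda>s. u (0 + k * s))"
    using lborel_integral_real_affine[of k u 0] k by simp
  then show "laplace (\<lambda>s. \<phi> (k * s)) q = laplace \<phi> (q / k) / k"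
    unfolding eq using k by (simp add: laplace_def set_lebesgue_integral_def u_def[abs_def])
qed

text \<open>
Only the part of the integral over \<open>]u, v]\<close> is kept, with the integrand replaced by its least possible
value there. For monotone \<open>\<phi>\<close> the next two lemmas choose \<open>u\<close> and \<open>v\<close> as multiples of \<open>1 / p\<close>; they show
that \<open>p \<cdot> laplace \<phi> p\<close> tends to infinity whenever \<open>\<phi> (1 / p)\<close> does.
\<close>

lemma laplace_ge:
  assumes ex: "laplace_exists \<phi> p" and nonneg: "\<And>t. 0 < t \<Longrightarrow> 0 \<le> \<phi> t"
    and c: "\<And>t. u < t \<Longrightarrow> t \<le> v \<Longrightarrow> c \<le> \<phi> t" and "0 \<le> u" "u \<le> v" "0 \<le> c" "0 \<le> p"
  shows "c * (v - u) * exp (- p * v) \<le> laplace \<phi> p"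
proof -
  have "c * (v - u) * exp (- p * v) = (\<integral>t. indicator {u<..v} t *\<^sub>R (c * exp (- p * v)) \<partial>lborel)"
    using \<open>u \<le> v\<close> by simp
  also have "\<dots> \<le> (\<integral>t. indicator {0<..} t *\<^sub>R (exp (- p * t) * \<phi> t) \<partial>lborel)"
  proof (rule integral_mono)
    show "integrable lborel (\<lambda>t. indicator {0<..} t *\<^sub>R (exp (- p * t) * \<phi> t))"
      using ex by (simp add: laplace_exists_def set_integrable_def)
    show "integrable lborel (\<lambda>t. indicator {u<..v} t *\<^sub>R (c * exp (- p * v)))"
      using \<open>u \<le> v\<close> by simp
    fix t :: real
    show "indicator {u<..v} t *\<^sub>R (c * exp (- p * v)) \<le> indicator {0<..} t *\<^sub>R (exp (- p * t) * \<phi> t)"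
    proof (cases "t \<in> {u<..v}")
      case True
      then have "c * exp (- p * v) \<le> \<phi> t * exp (- p * t)"
        using c[of t] \<open>0 \<le> c\<close> \<open>0 \<le> p\<close> by (intro mult_mono) (auto intro: mult_left_mono)
      then show ?thesis using True \<open>0 \<le> u\<close> by (simp add: mult.commute)
    next
      case False
      then show ?thesis using nonneg by (auto simp: indicator_def)
    qed
  qed
  finally show ?thesis by (simp add: laplace_def set_lebesgue_integral_def)
qed

lemma laplace_ge_antimono:
  assumes p: "0 < p" and ex: "laplace_exists \<phi> p" and nonneg: "\<And>t. 0 < t \<Longrightarrow> 0 \<le> \<phi> t"
    and anti: "\<And>s t. 0 < s \<Longrightarrow> s \<le> t \<Longrightarrow> \<phi> t \<le> \<phi> s"
  shows "\<phi> (1 / p) * exp (- 1) \<le> p * laplace \<phi> p"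
proof -
  have "\<phi> (1 / p) * (1 / p - 0) * exp (- p * (1 / p)) \<le> laplace \<phi> p"
    by (rule laplace_ge[OF ex nonneg]) (use p nonneg anti in auto)
  then show ?thesis using p by (simp add: field_simps)
qed

lemma laplace_ge_mono:
  assumes p: "0 < p" and ex: "laplace_exists \<phi> p" and nonneg: "\<And>t. 0 < t \<Longrightarrow> 0 \<le> \<phi> t"
    and mono: "\<And>s t. 0 < s \<Longrightarrow> s \<le> t \<Longrightarrow> \<phi> s \<le> \<phi> t"
  shows "\<phi> (1 / p) * exp (- 2) \<le> p * laplace \<phi> p"
proof -
  have "\<phi> (1 / p) * (2 / p - 1 / p) * exp (- p * (2 / p)) \<le> laplace \<phi> p"
    by (rule laplace_ge[OF ex nonneg]) (use p nonneg mono in \<open>auto simp: divide_right_mono\<close>)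
  moreover have "2 / p - 1 / p = 1 / p" by (simp add: diff_divide_distrib[symmetric])
  ultimately show ?thesis using p by (simp add: field_simps)
qed

text \<open>
Substituting \<open>t = s / p\<close> turns \<open>p \<cdot> laplace \<phi> p\<close> into the integral of \<open>exp (- s) \<cdot> \<phi> (s / p)\<close>, a mean of
the values \<open>\<phi> (s / p)\<close> with weights of total mass \<open>1\<close>. Dominated convergence applies for \<open>p\<close> tending to \<open>0\<close>
as well as for \<open>p\<close> tending to infinity, so the sequence \<open>p\<close> is left arbitrary.
\<close>

lemma laplace_abelian:
  fixes p :: "nat \<Rightarrow> real"
  assumes p: "\<And>n. 0 < p n" and ex: "\<And>q. 0 < q \<Longrightarrow> laplace_exists \<phi> q"
    and lim: "\<And>s. 0 < s \<Longrightarrow> (\<lambda>n. \<phi> (s / p n)) \<longlonglongrightarrow> l"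
    and w: "laplace_exists w 1" "\<And>n s. 0 < s \<Longrightarrow> \<bar>\<phi> (s / p n)\<bar> \<le> w s"
  shows "(\<lambda>n. p n * laplace \<phi> (p n)) \<longlonglongrightarrow> l"
proof -
  have scale: "laplace_exists (\<lambda>s. \<phi> (s / p n)) 1" "laplace (\<lambda>s. \<phi> (s / p n)) 1 = p n * laplace \<phi> (p n)" for n
    using laplace_scale[of "1 / p n" \<phi> 1] p[of n] ex[of "p n"] by (simp_all add: mult.commute)
  have "(\<lambda>n. laplace (\<lambda>s. \<phi> (s / p n)) 1) \<longlonglongrightarrow> laplace (\<lambda>_. l) 1"
    by (rule laplace_dominated_convergence) (use scale laplace_const lim w in auto)
  then show ?thesis by (simp add: scale laplace_const)
qed

section \<open>Limits of monotone functions\<close>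

lemma mono_limit_at_top:
  fixes \<phi> :: "real \<Rightarrow> real"
  assumes mono: "\<And>x y. 0 < x \<Longrightarrow> x \<le> y \<Longrightarrow> \<phi> x \<le> \<phi> y"
  shows "(\<exists>l. (\<phi> \<longlongrightarrow> l) at_top \<and> (\<forall>x>0. \<phi> x \<le> l)) \<or> filterlim \<phi> at_top at_top"
proof (cases "bdd_above (\<phi> ` {0<..})")
  case True
  define l where "l = (SUP x\<in>{0<..}. \<phi> x)"
  have le: "\<phi> x \<le> l" if "0 < x" for x
    unfolding l_def using True that by (intro cSUP_upper) auto
  have "(\<phi> \<longlongrightarrow> l) at_top"
  proof (rule order_tendstoI)
    fix y assume "y < l"
    then obtain x where x: "0 < x" "y < \<phi> x"
      unfolding l_def using True by (subst (asm) less_cSUP_iff) auto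
    then show "\<forall>\<^sub>F z in at_top. y < \<phi> z"
      using mono by (intro eventually_at_top_linorderI[of x]) (meson less_le_trans)
  next
    fix y assume "l < y"
    then show "\<forall>\<^sub>F z in at_top. \<phi> z < y"
      using le by (intro eventually_at_top_linorderI[of 1]) (meson le_less_trans less_le_trans zero_less_one)
  qed
  then show ?thesis using le by blast
next
  case False
  have "filterlim \<phi> at_top at_top"
    unfolding filterlim_at_top
  proof
    fix Z
    obtain x where "0 < x" "Z < \<phi> x" using False unfolding bdd_above_def by (force simp: not_le)
    then show "\<forall>\<^sub>F z in at_top. Z \<le> \<phi> z"
      using mono by (intro eventually_at_top_linorderI[of x]) (meson less_imp_le less_le_trans)
  qed
  then show ?thesis ..
qed

lemma antimono_limit_at_0:
  fixes \<phi> :: "real \<Rightarrow> real"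
  assumes anti: "\<And>x y. 0 < x \<Longrightarrow> x \<le> y \<Longrightarrow> \<phi> y \<le> \<phi> x"
  shows "(\<exists>l. (\<phi> \<longlongrightarrow> l) (at_right 0) \<and> (\<forall>x>0. \<phi> x \<le> l)) \<or> filterlim \<phi> at_top (at_right 0)"
proof -
  have "(\<exists>l. ((\<lambda>x. \<phi> (inverse x)) \<longlongrightarrow> l) at_top \<and> (\<forall>x>0. \<phi> (inverse x) \<le> l))
      \<or> filterlim (\<lambda>x. \<phi> (inverse x)) at_top at_top"
    using anti by (intro mono_limit_at_top) (simp add: le_imp_inverse_le)
  moreover have "(\<forall>x>0. \<phi> (inverse x) \<le> l) \<longleftrightarrow> (\<forall>x>0. \<phi> x \<le> l)" for l
    by (metis inverse_inverse_eq inverse_positive_iff_positive)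
  ultimately show ?thesis by (simp add: filterlim_at_right_to_top)
qed

lemma antimono_limit_at_top:
  fixes \<phi> :: "real \<Rightarrow> real"
  assumes anti: "\<And>x y. 0 < x \<Longrightarrow> x \<le> y \<Longrightarrow> \<phi> y \<le> \<phi> x" and nonneg: "\<And>x. 0 < x \<Longrightarrow> 0 \<le> \<phi> x"
  obtains l where "(\<phi> \<longlongrightarrow> l) at_top"
proof -
  have "(\<exists>l. ((\<lambda>x. - \<phi> x) \<longlongrightarrow> l) at_top \<and> (\<forall>x>0. - \<phi> x \<le> l)) \<or> filterlim (\<lambda>x. - \<phi> x) at_top at_top"
    using anti by (intro mono_limit_at_top) auto
  moreover have "\<not> filterlim (\<lambda>x. - \<phi> x) at_top at_top"
  proof
    assume "filterlim (\<lambda>x. - \<phi> x) at_top at_top"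
    then have "\<forall>\<^sub>F x in at_top. 1 \<le> - \<phi> x" unfolding filterlim_at_top by blast
    moreover have "\<forall>\<^sub>F x in at_top. 0 \<le> \<phi> x"
      using nonneg by (intro eventually_at_top_linorderI[of 1]) auto
    ultimately have "\<forall>\<^sub>F x in (at_top :: real filter). False"
      by eventually_elim auto
    then show False by simp
  qed
  ultimately obtain l where "((\<lambda>x. - \<phi> x) \<longlongrightarrow> l) at_top" by blast
  then show thesis using that[of "- l"] tendsto_minus[of "\<lambda>x. - \<phi> x"] by simp
qed

section \<open>Completely monotone functions as limits of exponential sums\<close>

definition completely_monotone :: "(real \<Rightarrow> real) \<Rightarrow> bool" where
  "completely_monotone g \<longleftrightarrow> smooth_pos g \<and> (\<forall>n. \<forall>t>0. 0 \<le> (- 1) ^ n * (deriv ^^ n) g t)"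

lemma completely_monotone_differentiable:
  "completely_monotone g \<Longrightarrow> 0 < t \<Longrightarrow> (deriv ^^ n) g differentiable (at t)"
  by (simp add: completely_monotone_def smooth_pos_def)

lemma completely_monotone_sign:
  "completely_monotone g \<Longrightarrow> 0 < t \<Longrightarrow> 0 \<le> (- 1) ^ n * (deriv ^^ n) g t"
  by (simp add: completely_monotone_def)

lemma completely_monotone_nonneg: "completely_monotone g \<Longrightarrow> 0 < t \<Longrightarrow> 0 \<le> g t"
  using completely_monotone_sign[of g t 0] by simp

lemma completely_monotone_continuous: "completely_monotone g \<Longrightarrow> continuous_on {0<..} g"
  using completely_monotone_differentiable[of g _ 0]
  by (intro continuous_at_imp_continuous_on) (auto intro: differentiable_imp_continuous_within)

lemma completely_monotone_antimono:
  fixes g :: "real \<Rightarrow> real"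
  assumes g: "completely_monotone g" and st: "0 < s" "s \<le> t"
  shows "g t \<le> g s"
proof (rule DERIV_nonpos_imp_nonincreasing[OF st(2)])
  fix x assume "s \<le> x" "x \<le> t"
  then have "0 < x" using st by simp
  then have "(g has_real_derivative deriv g x) (at x)" "deriv g x \<le> 0"
    using completely_monotone_differentiable[OF g, of x 0] completely_monotone_sign[OF g, of x 1] by (auto simp: DERIV_deriv_iff_real_differentiable)
  then show "\<exists>d. (g has_real_derivative d) (at x) \<and> d \<le> 0" by blast
qed

text \<open>
Bernstein's theorem that absolutely monotone functions are given by their Taylor series on the whole
interval. The functions \<open>E n\<close> are the successive derivatives of \<open>E 0\<close>. The Taylor remainder of order \<open>K\<close>
grows at least like the power \<open>K\<close> of the argument, and it is bounded by the function itself;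
comparing \<open>y\<close> with a point \<open>z > y\<close> therefore makes it at most \<open>(y / z)\<^sup>K \<cdot> E 0 z\<close>, which tends to \<open>0\<close>.
\<close>

lemma absolutely_monotone_taylor_sums:
  fixes E :: "nat \<Rightarrow> real \<Rightarrow> real" and a y :: real
  assumes der: "\<And>n y. y < a \<Longrightarrow> (E n has_real_derivative E (Suc n) y) (at y)"
    and nonneg: "\<And>n y. y < a \<Longrightarrow> 0 \<le> E n y"
    and y: "0 \<le> y" "y < a"
  shows "(\<lambda>k. E k 0 / fact k * y ^ k) sums E 0 y"
proof -
  define R where "R K n z = E n z - (\<Sum>k<K. E (n + k) 0 / fact k * z ^ k)" for K n z
  have R_le: "R K n z \<le> E n z" if "0 \<le> z" "z < a" for K n z
    using that nonneg by (auto simp: R_def intro!: sum_nonneg)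
  have R_der: "(R (Suc K) n has_real_derivative R K (Suc n) z) (at z)" if "z < a" for K n z
  proof -
    have "((\<lambda>z. \<Sum>k<Suc K. E (n + k) 0 / fact k * z ^ k) has_real_derivative
        (\<Sum>k<Suc K. E (n + k) 0 / fact k * (real k * z ^ (k - 1)))) (at z)"
      by (auto intro!: derivative_eq_intros simp: mult_ac)
    also have "(\<Sum>k<Suc K. E (n + k) 0 / fact k * (real k * z ^ (k - 1)))
        = (\<Sum>k<K. E (n + Suc k) 0 / fact (Suc k) * (real (Suc k) * z ^ k))"
      by (subst sum.lessThan_Suc_shift) simp
    also have "\<dots> = (\<Sum>k<K. E (Suc n + k) 0 / fact k * z ^ k)"
      by (intro sum.cong refl) (simp add: field_simps del: of_nat_Suc)
    finally show ?thesis
      unfolding R_def using der[OF that, of n] by (intro DERIV_diff) auto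
  qed
  have R_0: "R (Suc K) n 0 = 0" for K n
    by (simp add: R_def sum.lessThan_Suc_shift)
  have mono: "\<phi> 0 \<le> \<phi> z"
    if "0 \<le> z" "z < a" "\<And>w. 0 \<le> w \<Longrightarrow> w < a \<Longrightarrow> (\<phi> has_real_derivative \<psi> w) (at w)"
      "\<And>w. 0 \<le> w \<Longrightarrow> w < a \<Longrightarrow> 0 \<le> \<psi> w" for \<phi> \<psi> z
    by (rule DERIV_nonneg_imp_nondecreasing[OF \<open>0 \<le> z\<close>]) (use that in force)
  have R_nonneg: "0 \<le> R K n z" if "0 \<le> z" "z < a" for K n z
    using that
  proof (induction K arbitrary: n z)
    case 0
    then show ?case by (simp add: R_def nonneg)
  next
    case (Suc K)
    have "R (Suc K) n 0 \<le> R (Suc K) n z"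
      by (rule mono[OF Suc.prems, where \<psi> = "R K (Suc n)"]) (use R_der Suc.IH in auto)
    then show ?case by (simp add: R_0)
  qed
  \<comment> \<open>Induction on the order: in \<open>z\<close>, the derivative of the difference of the two sides is \<open>l\<close> times
    the difference for the next lower order, and the difference vanishes at \<open>0\<close>.\<close>
  have R_scale: "R K n (l * z) \<le> l ^ K * R K n z"
    if "0 \<le> z" "z < a" "0 \<le> l" "l \<le> 1" for K n z l
    using that(1,2)
  proof (induction K arbitrary: n z)
    case 0
    have "l * z \<le> z" using that 0 by (simp add: mult_left_le_one_le)
    then have "E n (l * z) \<le> E n z"
    proof (rule DERIV_nonneg_imp_nondecreasing)
      fix w assume "l * z \<le> w" "w \<le> z"
      then have "w < a" using 0 by simp
      then show "\<exists>d. (E n has_real_derivative d) (at w) \<and> 0 \<le> d"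
        using der nonneg by blast
    qed
    then show ?case by (simp add: R_def)
  next
    case (Suc K)
    let ?\<phi> = "\<lambda>z. l ^ Suc K * R (Suc K) n z - R (Suc K) n (l * z)"
    have "?\<phi> 0 \<le> ?\<phi> z"
    proof (rule mono[OF Suc.prems,
          where \<psi> = "\<lambda>z. l ^ Suc K * R K (Suc n) z - R K (Suc n) (l * z) * l"])
      fix w assume w: "0 \<le> w" "w < a"
      have lw: "l * w \<le> w" using that w by (simp add: mult_left_le_one_le)
      show "(?\<phi> has_real_derivative
          l ^ Suc K * R K (Suc n) w - R K (Suc n) (l * w) * l) (at w)"
        using w lw
        by (auto intro!: derivative_eq_intros R_der DERIV_chain2[where f = "R (Suc K) n"])
      have "l * R K (Suc n) (l * w) \<le> l * (l ^ K * R K (Suc n) w)"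
        using Suc.IH[OF w] that by (intro mult_left_mono) auto
      then show "0 \<le> l ^ Suc K * R K (Suc n) w - R K (Suc n) (l * w) * l"
        by (simp add: algebra_simps)
    qed
    then show ?case by (simp add: R_0)
  qed
  define z where "z = (y + a) / 2"
  define l where "l = y / z"
  have z: "0 < z" "z < a" "y < z" using y by (auto simp: z_def)
  have l: "0 \<le> l" "l < 1" "l * z = y" using z y by (auto simp: l_def)
  have "(\<lambda>K. R K 0 y) \<longlonglongrightarrow> 0"
  proof (rule tendsto_sandwich[of "\<lambda>_. 0" _ _ "\<lambda>K. l ^ K * E 0 z"])
    show "\<forall>\<^sub>F K in sequentially. 0 \<le> R K 0 y"
      using R_nonneg y by simp
    have "R K 0 y \<le> l ^ K * E 0 z" for K
    proof -
      have "R K 0 y \<le> l ^ K * R K 0 z" using R_scale[of z l K 0] l z by auto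
      also have "\<dots> \<le> l ^ K * E 0 z" using R_le[of z K 0] z l by (intro mult_left_mono) auto
      finally show ?thesis .
    qed
    then show "\<forall>\<^sub>F K in sequentially. R K 0 y \<le> l ^ K * E 0 z" by simp
    show "(\<lambda>K. l ^ K * E 0 z) \<longlonglongrightarrow> 0"
      using l by (intro tendsto_mult_left_zero LIMSEQ_power_zero) auto
  qed simp
  then have "(\<lambda>K. E 0 y - R K 0 y) \<longlonglongrightarrow> E 0 y - 0"
    by (intro tendsto_diff tendsto_const)
  then show ?thesis by (simp add: sums_def R_def)
qed

text \<open>
With \<open>E n y = (-1)\<^sup>n g\<^sup>(\<^sup>n\<^sup>) (A - y)\<close> and \<open>y = A exp (- t / A)\<close>, the Taylor series of the absolutely monotone
function \<open>E 0\<close> reads \<open>g (A (1 - exp (- t / A))) = \<Sum> c\<^sub>k exp (- k t / A)\<close> with \<open>c\<^sub>k \<ge> 0\<close>. The argument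
\<open>\<tau> = A (1 - exp (- t / A))\<close> tends to \<open>t\<close> as \<open>A\<close> grows, so truncating the series late enough gives the
approximation. As \<open>\<tau>\<close> lies above \<open>t / 3\<close> or above \<open>1 / 3\<close>, the approximants are bounded by
\<open>g (t / 3) + g (1 / 3)\<close>, which has a Laplace transform if \<open>g\<close> has one; this bound makes dominated
convergence applicable later on.
\<close>

lemma completely_monotone_exponential_sums:
  fixes g :: "real \<Rightarrow> real"
  assumes g: "completely_monotone g"
  shows "\<exists>(c :: nat \<Rightarrow> nat \<Rightarrow> real) (x :: nat \<Rightarrow> nat \<Rightarrow> real) (N :: nat \<Rightarrow> nat).
    (\<forall>m k. 0 \<le> c m k \<and> 0 \<le> x m k) \<and> (\<forall>m. inj (x m)) \<and>
    (\<forall>t>0. (\<lambda>m. \<Sum>k<N m. c m k * exp (- x m k * t)) \<longlonglongrightarrow> g t) \<and>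
    (\<forall>m. \<forall>t>0. (\<Sum>k<N m. c m k * exp (- x m k * t)) \<le> g (t / 3) + g (1 / 3))"
proof -
  note smooth = completely_monotone_differentiable[OF g] and sign = completely_monotone_sign[OF g]
  define a where "a m = real (Suc m)" for m
  define c where "c m k = (- 1) ^ k * (deriv ^^ k) g (a m) / fact k * a m ^ k" for m k
  define x where "x m k = real k / a m" for m k
  define \<tau> where "\<tau> m t = a m * (1 - exp (- t / a m))" for m t
  have a: "1 \<le> a m" "0 < a m" for m by (auto simp: a_def)
  have anti: "g t \<le> g s" if "0 < s" "s \<le> t" for s t
    by (rule completely_monotone_antimono[OF g that])
  have g_nonneg: "0 \<le> g t" if "0 < t" for t using sign[OF that, of 0] by simp
  have c_nonneg: "0 \<le> c m k" for m k
    unfolding c_def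
    by (rule mult_nonneg_nonneg, rule divide_nonneg_nonneg, rule sign) (use a[of m] in auto)
  have x_nonneg: "0 \<le> x m k" for m k using a[of m] by (simp add: x_def)
  have sums: "(\<lambda>k. c m k * exp (- x m k * t)) sums g (\<tau> m t)" if "0 < t" for m t
  proof -
    define y where "y = a m * exp (- t / a m)"
    define E where "E n y = (- 1) ^ n * (deriv ^^ n) g (a m - y)" for n y
    have y: "0 \<le> y" "y < a m" using a[of m] that by (auto simp: y_def)
    have der: "(E n has_real_derivative E (Suc n) y) (at y)" if "y < a m" for n y
    proof -
      have "((deriv ^^ n) g has_real_derivative (deriv ^^ Suc n) g (a m - y)) (at (a m - y))"
        using smooth[of "a m - y" n] that by (simp add: DERIV_deriv_iff_real_differentiable)
      then have "((\<lambda>y. (deriv ^^ n) g (a m - y)) has_real_derivative (deriv ^^ Suc n) g (a m - y) * (- 1)) (at y)"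
        by (rule DERIV_chain2) (auto intro!: derivative_eq_intros)
      from DERIV_cmult[OF this, of "(- 1) ^ n"] show ?thesis
        by (simp add: E_def[abs_def] algebra_simps)
    qed
    have "(\<lambda>k. E k 0 / fact k * y ^ k) sums E 0 y"
    proof (rule absolutely_monotone_taylor_sums[of "a m"])
      show "0 \<le> E n w" if "w < a m" for n w unfolding E_def by (rule sign) (use that in auto)
    qed (use der y in auto)
    moreover have "E k 0 / fact k * y ^ k = c m k * exp (- x m k * t)" for k
      by (simp add: E_def c_def x_def y_def power_mult_distrib flip: exp_of_nat_mult)
    moreover have "E 0 y = g (\<tau> m t)" by (simp add: E_def \<tau>_def y_def algebra_simps)
    ultimately show ?thesis by simp
  qed
  have \<tau>_le: "\<tau> m t \<le> t" for m t
  proof -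
    have "1 - exp (- t / a m) \<le> t / a m" using exp_ge_add_one_self[of "- t / a m"] by simp
    then have "\<tau> m t \<le> a m * (t / a m)" unfolding \<tau>_def using a[of m] by (intro mult_left_mono) auto
    then show ?thesis using a[of m] by simp
  qed
  have \<tau>_ge: "t * exp (- t / a m) \<le> \<tau> m t" for m t
  proof -
    have "t / a m * exp (- t / a m) \<le> (exp (t / a m) - 1) * exp (- t / a m)"
      using exp_ge_add_one_self[of "t / a m"] by (intro mult_right_mono) (linarith, simp)
    also have "\<dots> = 1 - exp (- t / a m)"
      by (simp add: left_diff_distrib flip: exp_add)
    finally have "a m * (t / a m * exp (- t / a m)) \<le> \<tau> m t"
      unfolding \<tau>_def using a[of m] by (intro mult_left_mono) auto
    then show ?thesis using a[of m] by simp
  qed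
  have \<tau>_lim: "(\<lambda>m. \<tau> m t) \<longlonglongrightarrow> t" for t
  proof (rule tendsto_sandwich[OF _ _ _ tendsto_const])
    have "(\<lambda>m. - t / a m) \<longlonglongrightarrow> 0"
      unfolding a_def by (intro real_tendsto_divide_at_top[OF tendsto_const] filterlim_compose[OF filterlim_real_sequentially] filterlim_Suc)
    then have "(\<lambda>m. t * exp (- t / a m)) \<longlonglongrightarrow> t * exp 0"
      by (intro tendsto_intros)
    then show "(\<lambda>m. t * exp (- t / a m)) \<longlonglongrightarrow> t" by simp
  qed (use \<tau>_le \<tau>_ge in auto)
  \<comment> \<open>All terms are nonnegative and nonincreasing in \<open>t\<close>, so a truncation that is good at \<open>t = 1 / a m\<close> is
    good at all later \<open>t\<close> as well.\<close>
  have "\<exists>N. g (\<tau> m (1 / a m)) - (\<Sum>k<N. c m k * exp (- x m k * (1 / a m))) < 1 / a m" for m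
  proof -
    have "(\<lambda>N. \<Sum>k<N. c m k * exp (- x m k * (1 / a m))) \<longlonglongrightarrow> g (\<tau> m (1 / a m))"
      using sums[of "1 / a m" m] a[of m] by (simp add: sums_def)
    then have "\<forall>\<^sub>F N in sequentially. g (\<tau> m (1 / a m)) - 1 / a m < (\<Sum>k<N. c m k * exp (- x m k * (1 / a m)))"
      using a[of m] by (intro order_tendstoD(1)) auto
    then show ?thesis by (auto simp: eventually_sequentially algebra_simps)
  qed
  then obtain N where N: "\<And>m. g (\<tau> m (1 / a m)) - (\<Sum>k<N m. c m k * exp (- x m k * (1 / a m))) < 1 / a m"
    by metis
  define G where "G m t = (\<Sum>k<N m. c m k * exp (- x m k * t))" for m t
  have G_le: "G m t \<le> g (\<tau> m t)" if "0 < t" for m t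
    unfolding G_def using sums[OF that, of m] c_nonneg
    by (metis (no_types, lifting) exp_ge_zero finite_lessThan mult_nonneg_nonneg sum_le_suminf sums_iff)
  have G_ge: "g (\<tau> m t) - 1 / a m \<le> G m t" if "1 / a m \<le> t" for m t
  proof -
    have t: "0 < t" using that a[of m] by (meson divide_pos_pos less_le_trans zero_less_one)
    let ?D = "\<lambda>k. c m k * exp (- x m k * (1 / a m)) - c m k * exp (- x m k * t)"
    have D: "?D sums (g (\<tau> m (1 / a m)) - g (\<tau> m t))"
      using a[of m] t by (intro sums_diff sums) auto
    have "0 \<le> ?D k" for k
    proof -
      have "exp (- x m k * t) \<le> exp (- x m k * (1 / a m))"
        using that x_nonneg[of m k] mult_left_mono[OF that, of "x m k"] by simp
      then show ?thesis using c_nonneg[of m k] by (simp add: mult_left_mono)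
    qed
    then have "sum ?D {..<N m} \<le> g (\<tau> m (1 / a m)) - g (\<tau> m t)"
      using D by (metis (no_types, lifting) finite_lessThan sum_le_suminf sums_iff)
    then show ?thesis using N[of m] by (simp add: G_def sum_subtractf)
  qed
  have G_lim: "(\<lambda>m. G m t) \<longlonglongrightarrow> g t" if t: "0 < t" for t
  proof -
    have inv: "(\<lambda>m. 1 / a m) \<longlonglongrightarrow> 0"
      unfolding a_def by (intro real_tendsto_divide_at_top[OF tendsto_const] filterlim_compose[OF filterlim_real_sequentially] filterlim_Suc)
    have "isCont g t" using smooth[OF t, of 0] by (auto intro: differentiable_imp_continuous_within)
    then have g_lim: "(\<lambda>m. g (\<tau> m t)) \<longlonglongrightarrow> g t"
      using \<tau>_lim by (rule isCont_tendsto_compose)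
    show ?thesis
    proof (rule tendsto_sandwich[OF _ _ _ g_lim])
      show "(\<lambda>m. g (\<tau> m t) - 1 / a m) \<longlonglongrightarrow> g t"
        using tendsto_diff[OF g_lim inv] by simp
      have "\<forall>\<^sub>F m in sequentially. 1 / a m < t"
        using order_tendstoD(2)[OF inv t] .
      then show "\<forall>\<^sub>F m in sequentially. g (\<tau> m t) - 1 / a m \<le> G m t"
        by eventually_elim (simp add: G_ge)
    qed (use G_le t in auto)
  qed
  have G_bound: "G m t \<le> g (t / 3) + g (1 / 3)" if t: "0 < t" for m t
  proof -
    have small: "s / 3 \<le> \<tau> m s" if "0 < s" "s \<le> a m" for s
    proof -
      have "1 / 3 \<le> exp (- 1 :: real)" using exp_le by (simp add: exp_minus field_simps)
      also have "\<dots> \<le> exp (- s / a m)" using that a[of m] by simp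
      finally have "s * (1 / 3) \<le> s * exp (- s / a m)" using that by (intro mult_left_mono) auto
      also have "\<dots> \<le> \<tau> m s" by (rule \<tau>_ge)
      finally show ?thesis by simp
    qed
    show ?thesis
    proof (cases "t \<le> a m")
      case True
      have "G m t \<le> g (t / 3)" using G_le[OF t] anti[OF _ small[OF t True]] t by (meson divide_pos_pos order_trans zero_less_numeral)
      then show ?thesis using g_nonneg[of "1 / 3"] by simp
    next
      case False
      have "1 / 3 \<le> a m / 3" using a[of m] by simp
      also have "\<dots> \<le> \<tau> m (a m)" using small[of "a m"] a[of m] by simp
      also have "\<dots> \<le> \<tau> m t"
        unfolding \<tau>_def using False a[of m] by (intro mult_left_mono) (auto simp: field_simps)
      finally have "g (\<tau> m t) \<le> g (1 / 3)" by (intro anti) auto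
      then show ?thesis using G_le[OF t, of m] g_nonneg[of "t / 3"] t by simp
    qed
  qed
  have "inj (x m)" for m using a[of m] by (auto simp: x_def inj_def)
  then show ?thesis
    using c_nonneg x_nonneg G_lim G_bound unfolding G_def
    by (intro exI[of _ c] exI[of _ x] exI[of _ N]) simp
qed

section \<open>Reciprocals of finite Stieltjes sums\<close>

text \<open>
Write the function as \<open>1 / S(p)\<close> with \<open>S(z) = z (a + \<Sum> c\<^sub>i / (z + x\<^sub>i)) = W(z) / Q(z)\<close> for complex
polynomials \<open>W\<close> and \<open>Q\<close>, where \<open>Q(z) = \<Prod> (z + x\<^sub>i)\<close>. From
\<open>S(z) = a z + \<Sum> c\<^sub>i - \<Sum> c\<^sub>i x\<^sub>i / (z + x\<^sub>i)\<close> one sees that the imaginary part of \<open>S(z)\<close> is a positive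
multiple of that of \<open>z\<close>, so the roots of \<open>W\<close> are real, and that
\<open>S'(z) = a + \<Sum> c\<^sub>i x\<^sub>i / (z + x\<^sub>i)\<^sup>2 > 0\<close> there, so they are simple. By the fundamental theorem of algebra
\<open>W\<close> then has as many roots as its degree, which is larger than that of \<open>Q\<close>, and Lagrange interpolation
of \<open>Q\<close> at these roots is the partial fraction expansion of \<open>Q / W\<close>, with residues \<open>1 / S' > 0\<close>. The roots are nonpositive because
\<open>S > 0\<close> on the positive half-line.
\<close>

lemma reciprocal_partial_fractions:
  fixes c x :: "nat \<Rightarrow> real" and a :: real
  assumes I: "finite I" "inj_on x I"
    and c: "\<And>i. i \<in> I \<Longrightarrow> 0 < c i" and x: "\<And>i. i \<in> I \<Longrightarrow> 0 < x i" and a: "0 < a"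
  shows "\<exists>J d. finite J \<and> (\<forall>y\<in>J. 0 \<le> y \<and> 0 < d y) \<and>
    (\<forall>p>0. 1 / (p * (a + (\<Sum>i\<in>I. c i / (p + x i)))) = (\<Sum>y\<in>J. d y / (p + y)))"
proof -
  define l where "l i = [:complex_of_real (x i), 1:]" for i
  define Q where "Q = (\<Prod>i\<in>I. l i)"
  define P where "P = smult (complex_of_real a) Q + (\<Sum>i\<in>I. smult (complex_of_real (c i)) (\<Prod>k\<in>I - {i}. l k))"
  define W where "W = [:0, 1:] * P"
  define S where "S z = z * (a + (\<Sum>i\<in>I. c i / (z + x i)))" for z :: complex
  have deg_l_prod: "degree (\<Prod>k\<in>A. l k) = card A" for A
    by (subst degree_prod_eq_sum_degree) (auto simp: l_def)
  have poly_Q: "poly Q z = (\<Prod>i\<in>I. z + x i)" for z :: complex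
    by (simp add: Q_def poly_prod l_def add_ac)
  have poly_Q0: "poly Q z \<noteq> 0 \<longleftrightarrow> (\<forall>i\<in>I. z + x i \<noteq> 0)" for z :: complex
    using I by (simp add: poly_Q)
  have poly_P: "poly P z = a * poly Q z + (\<Sum>i\<in>I. c i * (\<Prod>k\<in>I - {i}. z + x k))" for z :: complex
    by (simp add: P_def poly_sum poly_prod l_def add_ac)
  have poly_W: "poly W z = poly Q z * S z" if "poly Q z \<noteq> 0" for z :: complex
  proof -
    have "(\<Sum>i\<in>I. c i * (\<Prod>k\<in>I - {i}. z + x k)) = (\<Sum>i\<in>I. poly Q z * (c i / (z + x i)))"
    proof (intro sum.cong refl)
      fix i assume i: "i \<in> I"
      have "poly Q z = (z + x i) * (\<Prod>k\<in>I - {i}. z + x k)"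
        unfolding poly_Q using I i by (subst prod.remove[of _ i]) auto
      then show "c i * (\<Prod>k\<in>I - {i}. z + x k) = poly Q z * (c i / (z + x i))"
        using that i by (simp add: poly_Q0)
    qed
    then have "poly P z = poly Q z * (a + (\<Sum>i\<in>I. c i / (z + x i)))"
      unfolding poly_P by (simp add: sum_distrib_left distrib_left mult.commute)
    then show ?thesis
      by (simp add: W_def S_def)
  qed
  have Q_nz: "poly Q z \<noteq> 0" if "poly W z = 0" for z :: complex
  proof
    assume "poly Q z = 0"
    then obtain j where j: "j \<in> I" "z + x j = 0" using poly_Q0 by blast
    have "(\<Sum>i\<in>I. c i * (\<Prod>k\<in>I - {i}. z + x k)) = (\<Sum>i\<in>{j}. c i * (\<Prod>k\<in>I - {i}. z + x k))"
      using I j by (intro sum.mono_neutral_right) (auto intro!: prod_zero)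
    moreover have "z \<noteq> 0" using j x[of j] by auto
    ultimately have "c j * (\<Prod>k\<in>I - {j}. z + x k) = 0"
      using that \<open>poly Q z = 0\<close> by (simp add: W_def poly_P)
    then obtain k where k: "k \<in> I" "k \<noteq> j" "z + x k = 0"
      using c[OF j(1)] I by auto
    then have "complex_of_real (x k) = of_real (x j)"
      using j(2) by (metis add_left_cancel)
    then show False using k j I by (auto dest: inj_onD)
  qed
  have S_alt: "S z = a * z + (\<Sum>i\<in>I. c i) - (\<Sum>i\<in>I. c i * x i / (z + x i))" if "poly Q z \<noteq> 0" for z :: complex
  proof -
    have "(\<Sum>i\<in>I. z * (c i / (z + x i))) = (\<Sum>i\<in>I. c i - c i * x i / (z + x i))"
      using that by (intro sum.cong refl) (simp add: poly_Q0 field_simps)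
    then show ?thesis by (simp add: S_def sum_subtractf sum_distrib_left algebra_simps)
  qed
  have root_real: "Im z = 0" if "poly W z = 0" for z :: complex
  proof -
    have Qz: "poly Q z \<noteq> 0" using Q_nz[OF that] .
    have "S z = 0" using poly_W[OF Qz] that Qz by simp
    then have "0 = Im (a * z + (\<Sum>i\<in>I. c i) - (\<Sum>i\<in>I. c i * x i / (z + x i)))"
      using S_alt[OF Qz] by simp
    also have "\<dots> = Im z * (a + (\<Sum>i\<in>I. c i * x i / (cmod (z + x i))\<^sup>2))"
      by (simp add: Im_divide cmod_power2 sum_distrib_left algebra_simps sum_negf)
    finally have "Im z * (a + (\<Sum>i\<in>I. c i * x i / (cmod (z + x i))\<^sup>2)) = 0" by simp
    moreover have "0 < a + (\<Sum>i\<in>I. c i * x i / (cmod (z + x i))\<^sup>2)"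
      using a c x by (intro add_pos_nonneg sum_nonneg divide_nonneg_nonneg mult_nonneg_nonneg) (auto intro: less_imp_le)
    ultimately show ?thesis by simp
  qed
  \<comment> \<open>The value of \<open>S'\<close> at the real point \<open>- y\<close>.\<close>
  define \<delta> where "\<delta> y = a + (\<Sum>i\<in>I. c i * x i / (x i - y)\<^sup>2)" for y :: real
  have \<delta>_pos: "0 < \<delta> y" for y
    unfolding \<delta>_def using a c x
    by (intro add_pos_nonneg sum_nonneg divide_nonneg_nonneg mult_nonneg_nonneg) (auto intro: less_imp_le)
  have pderiv_W: "poly (pderiv W) z = poly Q z * \<delta> (- Re z)" if "poly W z = 0" for z :: complex
  proof -
    have Qz: "poly Q z \<noteq> 0" using Q_nz[OF that] .
    have Sz: "S z = 0" using poly_W[OF Qz] that Qz by simp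
    have z: "z = of_real (Re z)" using root_real[OF that] by (simp add: complex_eq_iff)
    have T_der: "((\<lambda>z. a * z + (\<Sum>i\<in>I. c i) - (\<Sum>i\<in>I. c i * x i / (z + x i))) has_field_derivative
        a - (\<Sum>i\<in>I. - (c i * x i / (z + x i)\<^sup>2))) (at z)"
      using Qz by (auto intro!: derivative_eq_intros simp: poly_Q0 power2_eq_square)
    have "((\<lambda>z. poly Q z * (a * z + (\<Sum>i\<in>I. c i) - (\<Sum>i\<in>I. c i * x i / (z + x i)))) has_field_derivative
        poly Q z * (a - (\<Sum>i\<in>I. - (c i * x i / (z + x i)\<^sup>2)))) (at z)"
      using DERIV_mult[OF poly_DERIV[of Q z] T_der] Sz S_alt[OF Qz] by (simp add: mult.commute)
    moreover have "open {w. poly Q w \<noteq> 0}"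
      by (intro open_Collect_neq continuous_intros)
    ultimately have "(poly W has_field_derivative
        poly Q z * (a - (\<Sum>i\<in>I. - (c i * x i / (z + x i)\<^sup>2)))) (at z)"
      by (rule has_field_derivative_transform_within_open) (use Qz in \<open>auto simp: poly_W S_alt\<close>)
    then have "poly (pderiv W) z = poly Q z * (a - (\<Sum>i\<in>I. - (c i * x i / (z + x i)\<^sup>2)))"
      using poly_DERIV DERIV_unique by blast
    also have "a - (\<Sum>i\<in>I. - (c i * x i / (z + x i)\<^sup>2)) = of_real (\<delta> (- Re z))"
      by (subst z) (simp add: \<delta>_def sum_negf add_ac)
    finally show ?thesis .
  qed
  define Z where "Z = {z. poly W z = 0}"
  have "rsquarefree W"
    unfolding rsquarefree_roots using pderiv_W Q_nz \<delta>_pos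
    by (metis less_irrefl mult_eq_0_iff of_real_eq_0_iff)
  have coeff_P: "coeff P (card I) = of_real a"
  proof -
    have "coeff Q (card I) = 1"
      using lead_coeff_prod[of l I] deg_l_prod[of I] by (simp add: Q_def l_def)
    moreover have "coeff (\<Prod>k\<in>I - {i}. l k) (card I) = 0" if "i \<in> I" for i
      using that I card_gt_0_iff[of I] by (intro coeff_eq_0) (auto simp: deg_l_prod)
    ultimately show ?thesis
      by (simp add: P_def coeff_sum)
  qed
  have deg_W: "card I < degree W"
  proof -
    have "card I \<le> degree P" "P \<noteq> 0" using coeff_P a by (auto intro!: le_degree)
    then show ?thesis by (simp add: W_def)
  qed
  then have "W \<noteq> 0" by auto
  then have finZ: "finite Z" unfolding Z_def by (rule poly_roots_finite)
  have W_eq: "W = smult (lead_coeff W) (\<Prod>z\<in>Z. [:- z, 1:])"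
    unfolding Z_def using complex_poly_decompose_rsquarefree[OF \<open>rsquarefree W\<close>] by simp
  have degW_Z: "degree W = card Z"
    using \<open>W \<noteq> 0\<close> by (subst W_eq) (simp add: degree_prod_eq_sum_degree)
  define V where "V z = W div [:- z, 1:]" for z :: complex
  have V: "W = [:- z, 1:] * V z" if "z \<in> Z" for z :: complex
    unfolding V_def using that
    by (intro dvd_mult_div_cancel[symmetric]) (simp add: Z_def poly_eq_0_iff_dvd)
  have degV: "degree (V z) < card Z" if "z \<in> Z" for z :: complex
  proof -
    have "V z \<noteq> 0" using V[OF that] \<open>W \<noteq> 0\<close> by auto
    then have "degree W = degree [:- z, 1:] + degree (V z)" 
      by (subst V[OF that], subst degree_mult_eq) auto
    then show ?thesis using degW_Z by simp
  qed
  have V_diag: "poly (V z) z = poly (pderiv W) z" if "z \<in> Z" for z :: complex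
    by (subst V[OF that], subst pderiv_mult) (simp add: pderiv_pCons)
  have V_off: "poly (V z) w = 0" if "z \<in> Z" "w \<in> Z" "w \<noteq> z" for z w
  proof -
    have "poly W w = 0" using that by (simp add: Z_def)
    then show ?thesis using that by (simp add: V[OF that(1)])
  qed
  \<comment> \<open>Lagrange interpolation: \<open>V z\<close> vanishes at the other roots of \<open>W\<close> and equals \<open>W' = Q S'\<close> at \<open>z\<close>.\<close>
  have Q_eq: "Q = (\<Sum>z\<in>Z. smult (of_real (1 / \<delta> (- Re z))) (V z))"
  proof (rule poly_eqI_degree[of Z])
    fix w assume w: "w \<in> Z"
    have "poly (\<Sum>z\<in>Z. smult (of_real (1 / \<delta> (- Re z))) (V z)) w
        = (\<Sum>z\<in>{w}. of_real (1 / \<delta> (- Re z)) * poly (V z) w)"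
      unfolding poly_sum poly_smult using w finZ V_off by (intro sum.mono_neutral_right) auto
    also have "\<dots> = poly Q w"
      using w \<delta>_pos[of "- Re w"] by (simp add: V_diag pderiv_W Z_def)
    finally show "poly Q w = poly (\<Sum>z\<in>Z. smult (of_real (1 / \<delta> (- Re z))) (V z)) w" by simp
  next
    show "degree Q < card Z" using deg_W degW_Z by (simp add: Q_def deg_l_prod)
    then show "degree (\<Sum>z\<in>Z. smult (of_real (1 / \<delta> (- Re z))) (V z)) < card Z"
      by (intro degree_sum_less) (auto intro: le_less_trans[OF degree_smult_le] degV)
  qed
  have S_of_real: "S (of_real p) = of_real (p * (a + (\<Sum>i\<in>I. c i / (p + x i))))" for p
    by (simp add: S_def)
  have S_pos: "0 < p * (a + (\<Sum>i\<in>I. c i / (p + x i)))" if "0 < p" for p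
    using that a c x
    by (intro mult_pos_pos add_pos_nonneg sum_nonneg less_imp_le[OF divide_pos_pos] add_pos_pos) auto
  have Q_pos: "poly Q (of_real p) \<noteq> 0" if "0 \<le> p" for p
  proof -
    have "p + x i \<noteq> 0" if "i \<in> I" for i using x[OF that] \<open>0 \<le> p\<close> by simp
    then show ?thesis unfolding poly_Q0 by (metis of_real_add of_real_eq_0_iff)
  qed
  define N where "N z = - Re z" for z :: complex
  have Z_real: "z = of_real (- N z)" if "z \<in> Z" for z :: complex
    using root_real that by (simp add: Z_def N_def complex_eq_iff)
  have N_inj: "inj_on N Z"
    by (rule inj_onI) (metis Z_real)
  show ?thesis
  proof (intro exI[of _ "N ` Z"] exI[of _ "\<lambda>y. 1 / \<delta> y"] conjI ballI allI impI)
    show "finite (N ` Z)" using finZ by simp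
    show "0 < 1 / \<delta> y" for y using \<delta>_pos by simp
    show "0 \<le> y" if "y \<in> N ` Z" for y
    proof (rule ccontr)
      assume "\<not> 0 \<le> y"
      moreover obtain z where z: "z \<in> Z" "y = N z" using \<open>y \<in> N ` Z\<close> by blast
      ultimately have "poly W (of_real (- y)) = 0" "0 < - y" using Z_real[OF z(1)] by (auto simp: Z_def)
      then show False
        using poly_W[of "of_real (- y)"] Q_pos[of "- y"] S_pos[of "- y"] S_of_real[of "- y"] 
        by (metis less_imp_le less_irrefl mult_eq_0_iff of_real_eq_0_iff)
    qed
    fix p :: real assume p: "0 < p"
    let ?p = "complex_of_real p"
    define s where "s = p * (a + (\<Sum>i\<in>I. c i / (p + x i)))"
    have s: "s \<noteq> 0" using S_pos[OF p] unfolding s_def by linarith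
    have Qp: "poly Q ?p \<noteq> 0" using Q_pos p by simp
    have W_s: "poly W ?p = poly Q ?p * of_real s"
      unfolding poly_W[OF Qp] S_of_real s_def ..
    then have Wp: "poly W ?p \<noteq> 0" using Qp s by simp
    have "of_real (1 / s) = poly Q ?p / poly W ?p"
      using Qp s by (simp add: W_s)
    also have "\<dots> = (\<Sum>z\<in>Z. of_real (1 / \<delta> (N z)) * poly (V z) ?p / poly W ?p)"
      by (subst (1) Q_eq) (simp add: poly_sum N_def sum_divide_distrib)
    also have "\<dots> = (\<Sum>z\<in>Z. of_real (1 / \<delta> (N z) / (p + N z)))"
    proof (intro sum.cong refl)
      fix z assume z: "z \<in> Z"
      have "poly W ?p = (?p - z) * poly (V z) ?p" by (subst V[OF z]) (simp add: algebra_simps)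
      moreover have "?p - z = of_real (p + N z)" by (subst Z_real[OF z]) simp
      ultimately have W: "poly W ?p = of_real (p + N z) * poly (V z) ?p" by metis
      then have "poly (V z) ?p \<noteq> 0" using Wp by auto
      then show "of_real (1 / \<delta> (N z)) * poly (V z) ?p / poly W ?p = of_real (1 / \<delta> (N z) / (p + N z))"
        unfolding W of_real_divide[of _ "p + N z"] by (simp del: of_real_add)
    qed
    also have "\<dots> = of_real (\<Sum>z\<in>Z. 1 / \<delta> (N z) / (p + N z))" by simp
    finally have "1 / s = (\<Sum>z\<in>Z. 1 / \<delta> (N z) / (p + N z))"
      unfolding of_real_eq_iff .
    then show "1 / (p * (a + (\<Sum>i\<in>I. c i / (p + x i)))) = (\<Sum>y\<in>N ` Z. 1 / \<delta> y / (p + y))"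
      by (simp add: s_def sum.reindex[OF N_inj])
  qed
qed

section \<open>Limits of transforms of exponential sums\<close>

lemma higher_deriv_Re_of_real:
  fixes g :: "complex \<Rightarrow> complex"
  assumes g: "g holomorphic_on {z. 0 < Re z}" and t: "0 < t"
  shows "(deriv ^^ n) (\<lambda>t. Re (g (of_real t))) t = Re ((deriv ^^ n) g (of_real t))"
    and "((deriv ^^ n) (\<lambda>t. Re (g (of_real t)))) differentiable at t"
proof -
  let ?f = "\<lambda>t. Re (g (of_real t))"
  have op: "open {z. 0 < Re z}" by (rule open_halfspace_Re_gt)
  have der: "((\<lambda>t. Re ((deriv ^^ n) g (of_real t))) has_real_derivative Re ((deriv ^^ Suc n) g (of_real t))) (at t)"
    if "0 < t" for n t
  proof -
    have "(deriv ^^ n) g holomorphic_on {z. 0 < Re z}"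
      by (rule holomorphic_higher_deriv[OF g op])
    then have "((deriv ^^ n) g has_field_derivative deriv ((deriv ^^ n) g) (of_real t)) (at (of_real t))"
      using that by (intro holomorphic_derivI[OF _ op]) auto
    then have "((\<lambda>t. (deriv ^^ n) g (of_real t)) has_vector_derivative (deriv ^^ Suc n) g (of_real t)) (at t)"
      by (auto intro: has_vector_derivative_real_field)
    from bounded_linear.has_vector_derivative[OF bounded_linear_Re this] show ?thesis
      by (simp add: has_real_derivative_iff_has_vector_derivative)
  qed
  have eq: "(deriv ^^ n) ?f t = Re ((deriv ^^ n) g (of_real t))" if "0 < t" for n t
    using that
  proof (induction n arbitrary: t)
    case (Suc n)
    have "((deriv ^^ n) ?f has_real_derivative Re ((deriv ^^ Suc n) g (of_real t))) (at t)"
      by (rule has_field_derivative_transform_within_open[OF der[OF Suc.prems], of "{0<..}"])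
        (use Suc in auto)
    then show ?case by (simp add: DERIV_imp_deriv)
  qed simp
  show "(deriv ^^ n) ?f t = Re ((deriv ^^ n) g (of_real t))" by (rule eq[OF t])
  have "((deriv ^^ n) ?f has_real_derivative Re ((deriv ^^ Suc n) g (of_real t))) (at t)"
    by (rule has_field_derivative_transform_within_open[OF der[OF t], of "{0<..}"])
      (use eq t in auto)
  then show "((deriv ^^ n) ?f) differentiable at t"
    by (auto simp: real_differentiable_def)
qed

lemma higher_deriv_sum_exp:
  fixes d x :: "'a \<Rightarrow> complex"
  shows "(deriv ^^ n) (\<lambda>z. \<Sum>y\<in>J. d y * exp (- x y * z)) = (\<lambda>z. \<Sum>y\<in>J. d y * (- x y) ^ n * exp (- x y * z))"
proof (induction n)
  case (Suc n)
  have "((\<lambda>z. \<Sum>y\<in>J. d y * (- x y) ^ n * exp (- x y * z)) has_field_derivative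
      (\<Sum>y\<in>J. d y * (- x y) ^ Suc n * exp (- x y * z))) (at z)" for z
    by (auto intro!: derivative_eq_intros simp: mult_ac)
  then show ?case
    unfolding funpow.simps o_def Suc.IH by (intro ext DERIV_imp_deriv)
qed simp

text \<open>
Since \<open>u \<le> exp u\<close> for \<open>u = (p + y) t\<close>, an exponential sum is bounded by \<open>exp (p t) / t\<close> times its
transform at \<open>p\<close>. Hence the sums, extended to the right half-plane, are locally bounded there, and Montel's
theorem yields a subsequence whose derivatives of every order converge; the limit inherits the
signs of the derivatives.
The factor \<open>exp (- p t) - exp (- q t)\<close> cancels the singularity \<open>1 / t\<close> of the bound, so differences of
transforms at two points converge by dominated convergence. Thus \<open>\<Phi>\<close> and the transform of the limit differ by a
constant, which is nonnegative by Fatou's lemma.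
\<close>

lemma limit_of_exponential_sums:
  fixes J :: "nat \<Rightarrow> real set" and d :: "nat \<Rightarrow> real \<Rightarrow> real" and \<Phi> :: "real \<Rightarrow> real"
  assumes y: "\<And>m y. y \<in> J m \<Longrightarrow> 0 \<le> y" and d: "\<And>m y. y \<in> J m \<Longrightarrow> 0 \<le> d m y"
    and lim: "\<And>p. 0 < p \<Longrightarrow> (\<lambda>m. \<Sum>y\<in>J m. d m y / (p + y)) \<longlonglongrightarrow> \<Phi> p"
  shows "\<exists>f b. licm f \<and> 0 \<le> b \<and> (\<forall>p>0. laplace_exists f p \<and> \<Phi> p = b + laplace f p)"
proof -
  define \<Psi> where "\<Psi> m p = (\<Sum>y\<in>J m. d m y / (p + y))" for m p
  define f where "f m t = (\<Sum>y\<in>J m. d m y * exp (- y * t))" for m t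
  define F where "F m z = (\<Sum>y\<in>J m. of_real (d m y) * exp (- of_real y * z))" for m and z :: complex
  define S where "S = {z::complex. 0 < Re z}"
  have S: "open S" unfolding S_def by (rule open_halfspace_Re_gt)
  have f_nonneg: "0 \<le> f m t" for m t
    unfolding f_def using d by (intro sum_nonneg mult_nonneg_nonneg) auto
  have F_of_real: "F m (of_real t) = of_real (f m t)" for m t
    by (simp add: F_def f_def exp_of_real[symmetric])
  have F_le: "norm (F m z) \<le> f m (Re z)" for m z
    unfolding F_def f_def using d
    by (intro sum_norm_le) (simp add: norm_mult norm_exp_eq_Re)
  have F_holo: "F m holomorphic_on A" for m A
    unfolding F_def by (intro holomorphic_intros)
  have f_le_\<Psi>: "f m t \<le> \<Psi> m p * (exp (p * t) / t)" if "0 < p" "0 < t" for m p t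
  proof -
    have "d m y * exp (- y * t) \<le> d m y / (p + y) * (exp (p * t) / t)" if "y \<in> J m" for y
    proof -
      have pos: "0 < (p + y) * t" using y[OF that] \<open>0 < p\<close> \<open>0 < t\<close> by (simp add: add_pos_nonneg)
      have "(p + y) * t \<le> exp ((p + y) * t)"
        using exp_ge_add_one_self[of "(p + y) * t"] by linarith
      also have "\<dots> = exp (p * t) * exp (y * t)"
        by (simp add: exp_add[symmetric] algebra_simps)
      finally have "exp (- y * t) \<le> exp (p * t) / ((p + y) * t)"
        using pos by (simp add: field_simps exp_minus)
      then have "d m y * exp (- y * t) \<le> d m y * (exp (p * t) / ((p + y) * t))"
        using d[OF that] by (rule mult_left_mono)
      then show ?thesis by simp
    qed
    then show ?thesis
      unfolding f_def \<Psi>_def sum_distrib_right by (rule sum_mono)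
  qed
  have "\<exists>B. \<forall>m. \<Psi> m p \<le> B" if "0 < p" for p
  proof -
    have "Bseq (\<lambda>m. \<Psi> m p)" using lim[OF that] unfolding \<Psi>_def by (blast intro: convergentI convergent_imp_Bseq)
    then show ?thesis unfolding Bseq_def by (metis abs_le_D1 real_norm_def)
  qed
  then obtain B where B: "\<And>p m. 0 < p \<Longrightarrow> \<Psi> m p \<le> B p" by metis
  have f_le: "f m t \<le> B p * (exp (p * t) / t)" if "0 < p" "0 < t" for m p t
  proof -
    have "f m t \<le> \<Psi> m p * (exp (p * t) / t)" by (rule f_le_\<Psi>[OF that])
    also have "\<dots> \<le> B p * (exp (p * t) / t)"
      using B[OF that(1)] that by (intro mult_right_mono) auto
    finally show ?thesis .
  qed
  obtain g r where g: "g holomorphic_on S" "strict_mono (r :: nat \<Rightarrow> nat)"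
    and g_lim: "\<And>z. z \<in> S \<Longrightarrow> (\<lambda>m. F (r m) z) \<longlonglongrightarrow> g z"
    and g_ulim: "\<And>K. compact K \<Longrightarrow> K \<subseteq> S \<Longrightarrow> uniform_limit K (F \<circ> r) g sequentially"
  proof (rule Montel[OF S, of "range F" F])
    fix K assume K: "compact K" "K \<subseteq> S"
    show "\<exists>B. \<forall>h\<in>range F. \<forall>z\<in>K. norm (h z) \<le> B"
    proof -
      have "continuous_on K (\<lambda>z. exp (Re z) / Re z)"
        using K by (intro continuous_intros) (auto simp: S_def)
      then have "bounded ((\<lambda>z. exp (Re z) / Re z) ` K)"
        using K compact_continuous_image compact_imp_bounded by blast
      then obtain C where C: "\<And>z. z \<in> K \<Longrightarrow> exp (Re z) / Re z \<le> C"
        unfolding bounded_iff by (metis abs_le_D1 imageI real_norm_def)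
      have "norm (F m z) \<le> B 1 * C" if "z \<in> K" for m z
      proof -
        have "0 < Re z" using that K by (auto simp: S_def)
        have "0 \<le> \<Psi> m 1"
          unfolding \<Psi>_def using d y by (intro sum_nonneg divide_nonneg_nonneg add_nonneg_nonneg) auto
        then have "0 \<le> B 1" using B[of 1 m] by simp
        have "norm (F m z) \<le> f m (Re z)" by (rule F_le)
        also have "\<dots> \<le> B 1 * (exp (1 * Re z) / Re z)"
          using \<open>0 < Re z\<close> by (intro f_le) auto
        also have "\<dots> \<le> B 1 * C"
          using C[OF that] \<open>0 \<le> B 1\<close> by (intro mult_left_mono) auto
        finally show ?thesis .
      qed
      then show ?thesis by auto
    qed
  next
    show "h holomorphic_on S" if "h \<in> range F" for h
      using that by (elim rangeE) (simp only: F_holo)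
    show "range F \<subseteq> range F" ..
    note obt = that
    show ?thesis if "g holomorphic_on S" "strict_mono (r :: nat \<Rightarrow> nat)"
      "\<And>z. z \<in> S \<Longrightarrow> (\<lambda>m. F (r m) z) \<longlonglongrightarrow> g z"
      "\<And>K. compact K \<Longrightarrow> K \<subseteq> S \<Longrightarrow> uniform_limit K (F \<circ> r) g sequentially" for g r
      using that by (rule obt)
  qed
  define f0 where "f0 t = Re (g (of_real t))" for t
  have f_lim: "(\<lambda>m. f (r m) t) \<longlonglongrightarrow> f0 t" if "0 < t" for t
    using tendsto_Re[OF g_lim[of "of_real t"]] that by (simp add: S_def F_of_real f0_def)
  have f0_deriv: "(deriv ^^ n) f0 t = Re ((deriv ^^ n) g (of_real t))"
    and f0_diff: "(deriv ^^ n) f0 differentiable at t" if "0 < t" for n t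
    using higher_deriv_Re_of_real[OF g(1)[unfolded S_def] that, of n] by (simp_all add: f0_def[abs_def])
  have f0_cm: "0 \<le> (- 1) ^ n * (deriv ^^ n) f0 t" if t: "0 < t" for n t
  proof -
    define A where "A = ball (complex_of_real t) (t / 2)"
    have "cball (complex_of_real t) (t / 2) \<subseteq> S"
    proof
      fix z assume "z \<in> cball (complex_of_real t) (t / 2)"
      then have "\<bar>Re (of_real t - z)\<bar> \<le> t / 2" using abs_Re_le_cmod[of "of_real t - z"] by (auto simp: dist_norm)
      then have "0 < Re z" using t by (simp add: abs_if split: if_splits)
      then show "z \<in> S" by (simp add: S_def)
    qed
    then have "uniform_limit A (F \<circ> r) g sequentially"
      by (intro uniform_limit_on_subset[OF g_ulim]) (auto simp: A_def)
    then have "(\<lambda>m. (deriv ^^ n) ((F \<circ> r) m) (of_real t)) \<longlonglongrightarrow> (deriv ^^ n) g (of_real t)"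
      by (rule higher_deriv_complex_uniform_limit) (use F_holo t in \<open>auto simp: A_def\<close>)
    then have "(\<lambda>m. (- 1) ^ n * Re ((deriv ^^ n) ((F \<circ> r) m) (of_real t))) \<longlonglongrightarrow> (- 1) ^ n * (deriv ^^ n) f0 t"
      unfolding f0_deriv[OF t] by (intro tendsto_intros)
    moreover have "0 \<le> (- 1) ^ n * Re ((deriv ^^ n) ((F \<circ> r) m) (of_real t))" for m
    proof -
      have "(deriv ^^ n) (F (r m)) (of_real t) = (\<Sum>y\<in>J (r m). of_real (d (r m) y) * (- of_real y) ^ n * exp (- of_real y * of_real t))"
        unfolding F_def[abs_def] higher_deriv_sum_exp ..
      also have "\<dots> = of_real (\<Sum>y\<in>J (r m). d (r m) y * (- y) ^ n * exp (- y * t))"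
        by (simp add: exp_of_real[symmetric])
      finally have "(- 1) ^ n * Re ((deriv ^^ n) ((F \<circ> r) m) (of_real t))
          = (\<Sum>y\<in>J (r m). (- 1) ^ n * (d (r m) y * (- y) ^ n * exp (- y * t)))"
        by (simp add: sum_distrib_left)
      also have "\<dots> = (\<Sum>y\<in>J (r m). d (r m) y * y ^ n * exp (- y * t))"
      proof (intro sum.cong refl)
        fix y :: real
        have "(- 1) ^ n * (- y) ^ n = y ^ n" by (simp flip: power_mult_distrib)
        moreover have "(- 1) ^ n * (d (r m) y * (- y) ^ n * exp (- y * t))
            = d (r m) y * ((- 1) ^ n * (- y) ^ n) * exp (- y * t)" by (simp only: ac_simps)
        ultimately show "(- 1) ^ n * (d (r m) y * (- y) ^ n * exp (- y * t)) = d (r m) y * y ^ n * exp (- y * t)"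
          by simp
      qed
      also have "0 \<le> \<dots>" using d y by (intro sum_nonneg mult_nonneg_nonneg) auto
      finally show ?thesis .
    qed
    ultimately show ?thesis by (blast intro: LIMSEQ_le_const)
  qed
  have f0_cont: "continuous_on {0<..} f0"
    using f0_diff[of _ 0] by (intro continuous_at_imp_continuous_on) (auto simp: differentiable_imp_continuous_within)
  have f0_nonneg: "0 \<le> f0 t" if "0 < t" for t
    using f0_cm[OF that, of 0] by simp
  have lap: "laplace_exists (f m) p" "laplace (f m) p = \<Psi> m p" if "0 < p" for m p
    using laplace_sum_exp[of p "J m" "\<lambda>y. y" "d m"] that y unfolding f_def[abs_def] \<Psi>_def by auto
  have r_lim: "(\<lambda>m. \<Psi> (r m) p) \<longlonglongrightarrow> \<Phi> p" if "0 < p" for p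
    using LIMSEQ_subseq_LIMSEQ[OF lim[OF that] g(2)] by (simp add: \<Psi>_def o_def)
  have fatou: "laplace_exists f0 p \<and> laplace f0 p \<le> \<Phi> p" if p: "0 < p" for p
  proof -
    define u where "u m t = indicator {0<..} t *\<^sub>R (exp (- p * t) * f (r m) t)" for m t
    define v where "v t = indicator {0<..} t *\<^sub>R (exp (- p * t) * f0 t)" for t
    have u_int: "integrable lborel (u m)" "integral\<^sup>L lborel (u m) = \<Psi> (r m) p" for m
      using lap[OF p, of "r m"] by (simp_all add: laplace_exists_def laplace_def set_integrable_def set_lebesgue_integral_def u_def[abs_def])
    have v_meas: "v \<in> borel_measurable borel"
      unfolding v_def[abs_def] by (intro borel_measurable_continuous_on_indicator continuous_intros f0_cont) auto
    have uv: "(\<lambda>m. u m t) \<longlonglongrightarrow> v t" for t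
      unfolding u_def v_def by (cases "0 < t") (auto intro!: tendsto_intros f_lim)
    have u_nonneg: "0 \<le> u m t" for m t by (simp add: u_def f_nonneg)
    have v_nonneg: "0 \<le> v t" for t using f0_nonneg by (simp add: v_def indicator_def)
    have "(\<integral>\<^sup>+t. ennreal (v t) \<partial>lborel) = (\<integral>\<^sup>+t. liminf (\<lambda>m. ennreal (u m t)) \<partial>lborel)"
      by (intro nn_integral_cong lim_imp_Liminf[symmetric] tendsto_ennrealI uv) simp
    also have "\<dots> \<le> liminf (\<lambda>m. \<integral>\<^sup>+t. ennreal (u m t) \<partial>lborel)"
      using borel_measurable_integrable[OF u_int(1)] by (intro nn_integral_liminf) auto
    also have "(\<lambda>m. \<integral>\<^sup>+t. ennreal (u m t) \<partial>lborel) = (\<lambda>m. ennreal (\<Psi> (r m) p))"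
      using u_int u_nonneg by (intro ext) (simp add: nn_integral_eq_integral)
    also have "liminf \<dots> = ennreal (\<Phi> p)"
      by (intro lim_imp_Liminf tendsto_ennrealI r_lim p) simp
    finally have le: "(\<integral>\<^sup>+t. ennreal (v t) \<partial>lborel) \<le> ennreal (\<Phi> p)" .
    have v_int: "integrable lborel v"
      using v_meas v_nonneg le by (intro integrableI_nonneg) (auto intro: le_less_trans)
    have "0 \<le> \<Phi> p"
      by (rule LIMSEQ_le_const[OF r_lim[OF p]]) (use d y p in \<open>auto simp: \<Psi>_def intro!: sum_nonneg divide_nonneg_nonneg add_nonneg_nonneg\<close>)
    then have "integral\<^sup>L lborel v \<le> \<Phi> p"
      using le v_int v_nonneg by (simp add: nn_integral_eq_integral)
    then show ?thesis
      using v_int by (simp add: laplace_exists_def laplace_def set_integrable_def set_lebesgue_integral_def v_def[abs_def])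
  qed
  have diff: "\<Phi> p - \<Phi> q = laplace f0 p - laplace f0 q" if pq: "0 < p" "p < q" for p q
  proof -
    have q: "0 < q" using pq by simp
    define u where "u m t = indicator {0<..} t *\<^sub>R (exp (- p * t) * f (r m) t) - indicator {0<..} t *\<^sub>R (exp (- q * t) * f (r m) t)" for m t
    define v where "v t = indicator {0<..} t *\<^sub>R (exp (- p * t) * f0 t) - indicator {0<..} t *\<^sub>R (exp (- q * t) * f0 t)" for t
    define w where "w t = (q - p) * B (p / 2) * (indicator {0<..} t *\<^sub>R exp (- (p / 2) * t))" for t
    have u_int: "integrable lborel (u m)" "integral\<^sup>L lborel (u m) = \<Psi> (r m) p - \<Psi> (r m) q" for m
      using lap[OF pq(1), of "r m"] lap[OF q, of "r m"]
      by (simp_all add: laplace_exists_def laplace_def set_integrable_def set_lebesgue_integral_def u_def[abs_def])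
    have v_int: "integrable lborel v" "integral\<^sup>L lborel v = laplace f0 p - laplace f0 q"
      using fatou[OF pq(1)] fatou[OF q]
      by (simp_all add: laplace_exists_def laplace_def set_integrable_def set_lebesgue_integral_def v_def[abs_def])
    have w_int: "integrable lborel w"
      using laplace_exp(1)[of "p / 2" 0] pq
      unfolding w_def[abs_def] by (intro integrable_mult_right) (simp add: laplace_exists_def set_integrable_def)
    have uv: "(\<lambda>m. u m t) \<longlonglongrightarrow> v t" for t
      unfolding u_def v_def by (cases "0 < t") (auto intro!: tendsto_intros f_lim)
    have uw: "norm (u m t) \<le> w t" for m t
    proof (cases "0 < t")
      case True
      have "1 - exp (- (q - p) * t) \<le> (q - p) * t"
        using exp_ge_add_one_self[of "- (q - p) * t"] by linarith
      then have 1: "exp (- p * t) * (1 - exp (- (q - p) * t)) \<le> exp (- p * t) * ((q - p) * t)"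
        by (intro mult_left_mono) auto
      have 2: "exp (- p * t) * (1 - exp (- (q - p) * t)) = exp (- p * t) - exp (- q * t)"
        by (simp add: algebra_simps flip: exp_add)
      have ge: "0 \<le> exp (- p * t) - exp (- q * t)" using pq True by simp
      have "norm (u m t) = (exp (- p * t) - exp (- q * t)) * f (r m) t"
        using True ge f_nonneg[of "r m" t] by (simp add: u_def left_diff_distrib[symmetric] abs_mult)
      also have "\<dots> \<le> exp (- p * t) * ((q - p) * t) * (B (p / 2) * (exp (p / 2 * t) / t))"
      proof (rule mult_mono[OF 1[unfolded 2]])
        show "f (r m) t \<le> B (p / 2) * (exp (p / 2 * t) / t)"
          using pq True by (intro f_le) auto
      qed (use f_nonneg[of "r m" t] pq True in auto)
      also have "\<dots> = (q - p) * B (p / 2) * (exp (- p * t) * exp (p / 2 * t))"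
        using True by simp
      also have "exp (- p * t) * exp (p / 2 * t) = exp (- (p / 2) * t)"
        by (simp flip: exp_add)
      finally show ?thesis using True by (simp add: w_def)
    qed (simp add: u_def w_def)
    have "(\<lambda>m. integral\<^sup>L lborel (u m)) \<longlonglongrightarrow> integral\<^sup>L lborel v"
      by (rule integral_dominated_convergence[of _ _ _ w])
        (use u_int v_int w_int uv uw in \<open>auto intro: borel_measurable_integrable\<close>)
    moreover have "(\<lambda>m. integral\<^sup>L lborel (u m)) \<longlonglongrightarrow> \<Phi> p - \<Phi> q"
      unfolding u_int by (intro tendsto_diff r_lim pq q)
    ultimately show ?thesis unfolding v_int by (metis LIMSEQ_unique)
  qed
  show ?thesis
  proof (intro exI[of _ f0] exI[of _ "\<Phi> 1 - laplace f0 1"] conjI allI impI)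
    show "0 \<le> \<Phi> 1 - laplace f0 1" using fatou[of 1] by simp
    show "laplace_exists f0 p" if "0 < p" for p
      using fatou[OF that] ..
    show "\<Phi> p = \<Phi> 1 - laplace f0 1 + laplace f0 p" if "0 < p" for p
      using diff[of p 1] diff[of 1 p] that by (cases p "1::real" rule: linorder_cases) auto
    show "licm f0"
      unfolding licm_def smooth_pos_def
    proof (intro conjI allI impI)
      have "set_integrable lborel {0<..} (\<lambda>t. exp (- 1 * t) * f0 t)"
        using fatou[of 1] by (simp add: laplace_exists_def)
      then have int: "set_integrable lborel {0<..<1} (\<lambda>t. exp (- 1 * t) * f0 t)"
        by (rule set_integrable_subset) auto
      have "set_integrable lborel {0<..<1} f0"
      proof (rule set_integrable_bound[OF set_integrable_mult_right[OF int, of "exp 1"]])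
        show "set_borel_measurable lborel {0<..<1} f0"
        proof -
          have "(\<lambda>t. indicator {0<..<1} t *\<^sub>R f0 t) \<in> borel_measurable borel"
            by (rule borel_measurable_continuous_on_indicator) (auto intro: continuous_on_subset[OF f0_cont])
          then show ?thesis by (simp add: set_borel_measurable_def)
        qed
        have "f0 t \<le> exp 1 * (exp (- 1 * t) * f0 t)" if "0 < t" "t < 1" for t
        proof -
          have "1 \<le> exp 1 * exp (- 1 * t)" using that by (simp flip: exp_add)
          then have "1 * f0 t \<le> (exp 1 * exp (- 1 * t)) * f0 t"
            using f0_nonneg that by (intro mult_right_mono) auto
          then show ?thesis by (simp add: mult.assoc)
        qed
        then show "AE x in lborel. x \<in> {0<..<1} \<longrightarrow> norm (f0 x) \<le> norm (exp 1 * (exp (- 1 * x) * f0 x))"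
          using f0_nonneg by (auto simp: abs_mult)
      qed
      then show "\<exists>\<epsilon>>0. set_integrable lborel {0<..<\<epsilon>} f0"
        by (intro exI[of _ 1]) auto
    qed (use f0_diff f0_cm in auto)
  qed
qed

section \<open>Reciprocals of transforms of completely monotone functions\<close>

text \<open>
The approximating exponential sums are multiplied by \<open>exp (- \<epsilon> t)\<close> and \<open>\<epsilon>\<close> is added to the constant, with
\<open>\<epsilon> \<rightarrow> 0\<close>: this makes all exponents and the constant strictly positive, as the partial fraction
expansion demands. Terms with coefficient \<open>0\<close> are dropped for the same reason.
\<close>

theorem reciprocal_of_completely_monotone_laplace:
  fixes g :: "real \<Rightarrow> real" and a :: real
  assumes g: "completely_monotone g"
    and ex: "\<And>p. 0 < p \<Longrightarrow> laplace_exists g p"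
    and a: "0 \<le> a" and pos: "\<And>p. 0 < p \<Longrightarrow> 0 < a + laplace g p"
  shows "\<exists>f b. licm f \<and> 0 \<le> b \<and>
    (\<forall>p>0. laplace_exists f p \<and> 1 / (p * (a + laplace g p)) = b + laplace f p)"
proof -
  obtain c x :: "nat \<Rightarrow> nat \<Rightarrow> real" and N :: "nat \<Rightarrow> nat"
    where cx: "\<forall>m k. 0 \<le> c m k \<and> 0 \<le> x m k" and inj: "\<forall>m. inj (x m)"
      and G: "\<forall>t>0. (\<lambda>m. \<Sum>k<N m. c m k * exp (- x m k * t)) \<longlonglongrightarrow> g t"
        "\<forall>m. \<forall>t>0. (\<Sum>k<N m. c m k * exp (- x m k * t)) \<le> g (t / 3) + g (1 / 3)"
    using completely_monotone_exponential_sums[OF g] by (elim exE conjE)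
  note c = cx[rule_format, THEN conjunct1] and x = cx[rule_format, THEN conjunct2]
    and G_lim = G(1)[rule_format] and G_le = G(2)[rule_format]
  define \<epsilon> where "\<epsilon> m = inverse (real (Suc m))" for m
  have \<epsilon>: "0 < \<epsilon> m" for m by (simp add: \<epsilon>_def)
  have \<epsilon>_lim: "\<epsilon> \<longlonglongrightarrow> 0" unfolding \<epsilon>_def[abs_def] by (rule LIMSEQ_inverse_real_of_nat)
  define G where "G m t = (\<Sum>k<N m. c m k * exp (- (x m k + \<epsilon> m) * t))" for m t
  define S where "S m p = a + \<epsilon> m + (\<Sum>k<N m. c m k / (p + (x m k + \<epsilon> m)))" for m p
  have G_eq: "G m t = exp (- \<epsilon> m * t) * (\<Sum>k<N m. c m k * exp (- x m k * t))" for m t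
    by (simp add: G_def sum_distrib_left algebra_simps flip: exp_add)
  have G_laplace: "laplace_exists (G m) p" "laplace (G m) p = (\<Sum>k<N m. c m k / (p + (x m k + \<epsilon> m)))"
    if "0 < p" for m p
    using laplace_sum_exp[of p "{..<N m}" "\<lambda>k. x m k + \<epsilon> m" "c m"] that x \<epsilon>
    unfolding G_def[abs_def] by (simp_all add: add_nonneg_nonneg less_imp_le)
  have S_lim: "(\<lambda>m. S m p) \<longlonglongrightarrow> a + laplace g p" if p: "0 < p" for p
  proof -
    have "(\<lambda>m. laplace (G m) p) \<longlonglongrightarrow> laplace g p"
    proof (rule laplace_dominated_convergence)
      have "laplace_exists (\<lambda>t. g (1 / 3 * t)) p"
        using p by (intro laplace_scale ex) auto
      moreover have "laplace_exists (\<lambda>t. g (1 / 3)) p"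
        using p by (rule laplace_const)
      ultimately show "laplace_exists (\<lambda>t. g (t / 3) + g (1 / 3)) p"
        unfolding laplace_exists_def by (simp add: distrib_left set_integral_add)
      fix m and t :: real assume t: "0 < t"
      have pos: "0 \<le> (\<Sum>k<N m. c m k * exp (- x m k * t))"
        using c by (intro sum_nonneg mult_nonneg_nonneg) auto
      have "G m t \<le> 1 * (\<Sum>k<N m. c m k * exp (- x m k * t))"
        unfolding G_eq using t pos \<epsilon>[of m] by (intro mult_right_mono) auto
      then show "\<bar>G m t\<bar> \<le> g (t / 3) + g (1 / 3)"
        using G_le[OF t, of m] pos by (simp add: G_eq abs_mult)
    next
      fix t :: real assume t: "0 < t"
      have "(\<lambda>m. exp (- \<epsilon> m * t) * (\<Sum>k<N m. c m k * exp (- x m k * t))) \<longlonglongrightarrow> exp (- 0 * t) * g t"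
        by (intro tendsto_intros \<epsilon>_lim G_lim t)
      then show "(\<lambda>m. G m t) \<longlonglongrightarrow> g t" by (simp add: G_eq)
    qed (use G_laplace ex p in auto)
    then have "(\<lambda>m. a + \<epsilon> m + laplace (G m) p) \<longlonglongrightarrow> a + 0 + laplace g p"
      by (intro tendsto_intros \<epsilon>_lim)
    then show ?thesis using p by (simp add: S_def G_laplace)
  qed
  have "\<exists>J d. (\<forall>y\<in>J. 0 \<le> y \<and> 0 < d y) \<and> (\<forall>p>0. 1 / (p * S m p) = (\<Sum>y\<in>J. d y / (p + y)))" for m
  proof -
    define I where "I = {k. k < N m \<and> 0 < c m k}"
    have I: "finite I" by (simp add: I_def)
    have I_inj: "inj_on (\<lambda>k. x m k + \<epsilon> m) I" using inj by (auto simp: inj_on_def)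
    have c_pos: "0 < c m k" if "k \<in> I" for k using that by (simp add: I_def)
    have x_pos: "0 < x m k + \<epsilon> m" for k using x \<epsilon> by (simp add: add_nonneg_pos)
    have a_pos: "0 < a + \<epsilon> m" using a \<epsilon> by (simp add: add_nonneg_pos)
    have "\<exists>J d. finite J \<and> (\<forall>y\<in>J. 0 \<le> y \<and> 0 < d y) \<and>
      (\<forall>p>0. 1 / (p * (a + \<epsilon> m + (\<Sum>k\<in>I. c m k / (p + (x m k + \<epsilon> m))))) = (\<Sum>y\<in>J. d y / (p + y)))"
      by (rule reciprocal_partial_fractions) (use I I_inj c_pos x_pos a_pos in auto)
    moreover have "(\<Sum>k<N m. c m k / (p + (x m k + \<epsilon> m))) = (\<Sum>k\<in>I. c m k / (p + (x m k + \<epsilon> m)))" for p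
      using c by (intro sum.mono_neutral_right) (auto simp: I_def less_le)
    ultimately show ?thesis unfolding S_def by simp blast
  qed
  then obtain J d where J: "\<And>m y. y \<in> J m \<Longrightarrow> 0 \<le> y" "\<And>m y. y \<in> J m \<Longrightarrow> 0 < d m y"
    "\<And>m p. 0 < p \<Longrightarrow> 1 / (p * S m p) = (\<Sum>y\<in>J m. d m y / (p + y))"
    by metis
  have lim: "(\<lambda>m. \<Sum>y\<in>J m. d m y / (p + y)) \<longlonglongrightarrow> 1 / (p * (a + laplace g p))" if "0 < p" for p
    unfolding J(3)[OF that, symmetric] using pos[OF that] that
    by (intro tendsto_intros S_lim) auto
  show ?thesis
    by (rule limit_of_exponential_sums[of J d]) (use J lim in \<open>auto intro: less_imp_le\<close>)
qed

section \<open>Bernstein functions\<close>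

lemma bernstein_deriv_completely_monotone:
  assumes "bernstein h"
  shows "completely_monotone (deriv h)"
proof -
  have shift: "(deriv ^^ n) (deriv h) = (deriv ^^ Suc n) h" for n
    by (simp add: funpow_swap1)
  have "0 \<le> (- 1) ^ n * (deriv ^^ n) (deriv h) t" if "0 < t" for n t
  proof -
    have "(- 1) ^ Suc n * (deriv ^^ Suc n) h t \<le> 0"
      using assms that unfolding bernstein_def by (metis One_nat_def Suc_le_mono le0)
    then show ?thesis unfolding shift by simp
  qed
  moreover have "smooth_pos (deriv h)"
    using assms unfolding smooth_pos_def shift bernstein_def by blast
  ultimately show ?thesis by (simp add: completely_monotone_def)
qed

lemma bernstein_has_real_derivative:
  assumes "bernstein h" "0 < t"
  shows "(h has_real_derivative deriv h t) (at t)"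
proof -
  have "(deriv ^^ 0) h differentiable (at t)"
    using assms unfolding bernstein_def smooth_pos_def by blast
  then show ?thesis by (simp add: DERIV_deriv_iff_real_differentiable)
qed

lemma bernstein_mono:
  assumes h: "bernstein h" and "0 \<le> s" "s \<le> t"
  shows "h s \<le> h t"
proof (rule DERIV_nonneg_imp_increasing_open[OF \<open>s \<le> t\<close>])
  fix x assume "s < x" "x < t"
  then show "\<exists>y. (h has_real_derivative y) (at x) \<and> 0 \<le> y"
    using assms(2) bernstein_has_real_derivative[OF h, of x]
      completely_monotone_nonneg[OF bernstein_deriv_completely_monotone[OF h], of x] by auto
next
  show "continuous_on {s..t} h"
    using h assms(2) unfolding bernstein_def by (auto intro: continuous_on_subset)
qed

lemma bernstein_tendsto_at_0:
  assumes h: "bernstein h"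
  shows "(h \<longlongrightarrow> h 0) (at_right 0)"
proof (rule tendsto_within_subset)
  show "(h \<longlongrightarrow> h 0) (at 0 within {0..})"
    using h unfolding bernstein_def continuous_on_def by auto
qed auto

lemma bernstein_nonneg:
  assumes h: "bernstein h" and "0 \<le> t"
  shows "0 \<le> h t"
proof (cases "t = 0")
  case True
  note bernstein_tendsto_at_0[OF h]
  then have "0 \<le> h 0"
  proof (rule tendsto_lowerbound)
    show "\<forall>\<^sub>F x in at_right 0. 0 \<le> h x"
      by (rule eventually_mono[OF eventually_at_right_less]) (use h in \<open>simp add: bernstein_def\<close>)
  qed simp
  then show ?thesis using True by simp
next
  case False
  then show ?thesis using assms by (simp add: bernstein_def)
qed

text \<open>
A Bernstein function is concave and so grows at most linearly; an exponential bound with arbitrarily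
small rate is the form of this that suits Laplace integrals.
\<close>

lemma bernstein_le_exp:
  assumes h: "bernstein h" and q: "0 < q" and t: "0 < t"
  shows "h t \<le> (h 1 + deriv h 1 / q) * exp (q * t)"
proof -
  note cm = bernstein_deriv_completely_monotone[OF h]
  have deriv_nonneg: "0 \<le> deriv h t" if "0 < t" for t by (rule completely_monotone_nonneg[OF cm that])
  have "h t \<le> h 1 + deriv h 1 * t"
  proof (cases "t \<le> 1")
    case True
    then show ?thesis using bernstein_mono[OF h, of t 1] deriv_nonneg[of 1] t by (simp add: add_increasing2)
  next
    case False
    then obtain z where z: "1 < z" "z < t" "h t - h 1 = (t - 1) * deriv h z"
      using MVT2[of 1 t h "deriv h"] bernstein_has_real_derivative[OF h] by force
    have "deriv h z \<le> deriv h 1"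
      using completely_monotone_antimono[OF cm, of 1 z] z by simp
    then have "(t - 1) * deriv h z \<le> t * deriv h 1"
      using False deriv_nonneg[of z] z by (intro mult_mono) auto
    then show ?thesis using z by (simp add: mult.commute)
  qed
  also have "\<dots> \<le> h 1 * exp (q * t) + deriv h 1 * (1 / q * exp (q * t))"
  proof (intro add_mono mult_left_mono deriv_nonneg)
    show "h 1 \<le> h 1 * exp (q * t)"
      using q t bernstein_nonneg[OF h, of 1] by (simp add: mult_le_cancel_left1)
    show "t \<le> 1 / q * exp (q * t)"
    proof -
      have "q * t \<le> exp (q * t)" using exp_ge_add_one_self[of "q * t"] by linarith
      then show ?thesis using q by (simp add: field_simps)
    qed
  qed simp
  also have "\<dots> = (h 1 + deriv h 1 / q) * exp (q * t)" by (simp add: algebra_simps)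
  finally show ?thesis .
qed

lemma bernstein_laplace_exists:
  assumes h: "bernstein h" and p: "0 < p"
  shows "laplace_exists h p"
proof (rule laplace_exists_if_dominated)
  define C where "C = h 1 + deriv h 1 / (p / 2)"
  show "continuous_on {0<..} h" using h unfolding bernstein_def by (auto intro: continuous_on_subset)
  have "laplace_exists (\<lambda>t. exp (- (- p / 2) * t)) p"
    using p by (intro laplace_exp) auto
  then have "set_integrable lborel {0<..} (\<lambda>t. C * (exp (- p * t) * exp (- (- p / 2) * t)))"
    unfolding laplace_exists_def by (rule set_integrable_mult_right)
  then show "laplace_exists (\<lambda>t. C * exp (p / 2 * t)) p"
    unfolding laplace_exists_def by (simp add: mult_ac)
  show "\<bar>h t\<bar> \<le> C * exp (p / 2 * t)" if "0 < t" for t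
    using bernstein_le_exp[OF h, of "p / 2" t] bernstein_nonneg[OF h, of t] p that by (simp add: C_def)
qed

text \<open>
Integration by parts, with the antiderivative \<open>exp (- p t) \<cdot> h t\<close>. The derivative of \<open>h\<close> may be
unbounded at \<open>0\<close>; it is integrable there since it is nonnegative and \<open>h\<close> is continuous at \<open>0\<close>.
\<close>

lemma bernstein_laplace_deriv:
  assumes h: "bernstein h" and p: "0 < p"
  shows "laplace_exists (deriv h) p" "laplace (deriv h) p = p * laplace h p - h 0"
proof -
  note cm = bernstein_deriv_completely_monotone[OF h]
  have nonneg: "0 \<le> deriv h t" if "0 < t" for t by (rule completely_monotone_nonneg[OF cm that])
  have cont: "continuous_on {0<..} (deriv h)" by (rule completely_monotone_continuous[OF cm])
  then have isCont: "isCont (deriv h) t" if "0 < t" for t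
    using that by (simp add: continuous_on_eq_continuous_at)
  have isCont_h: "isCont h t" if "0 < t" for t
    using bernstein_has_real_derivative[OF h that] by (rule DERIV_isCont)
  note h0 = bernstein_tendsto_at_0[OF h]
  have near: "set_integrable lborel {0<..<1} (deriv h)"
  proof -
    have "set_integrable lborel (einterval 0 1) (deriv h)"
    proof (rule interval_integral_FTC_nonneg(1))
      show "((h \<circ> real_of_ereal) \<longlongrightarrow> h 0) (at_right 0)"
        unfolding zero_ereal_def ereal_tendsto_simps by (rule h0)
      show "((h \<circ> real_of_ereal) \<longlongrightarrow> h 1) (at_left 1)"
        unfolding one_ereal_def ereal_tendsto_simps
        using isCont_h[of 1] by (auto simp: isCont_def intro: tendsto_within_subset)
    qed (use bernstein_has_real_derivative[OF h] isCont nonneg in auto)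
    moreover have "einterval 0 1 = {0<..<1::real}" by (auto simp: einterval_def)
    ultimately show ?thesis by simp
  qed
  show ex: "laplace_exists (deriv h) p"
  proof -
    define w where "w t = indicator {0<..<1} t *\<^sub>R deriv h t + indicator {0<..} t *\<^sub>R (deriv h 1 * exp (- p * t))" for t
    have "laplace_exists (\<lambda>t. exp (- 0 * t)) p" using p by (intro laplace_exp) auto
    then have "set_integrable lborel {0<..} (\<lambda>t. deriv h 1 * exp (- p * t))"
      unfolding laplace_exists_def by (intro set_integrable_mult_right) simp
    then have w: "integrable lborel w"
      using near unfolding w_def[abs_def] set_integrable_def by (rule Bochner_Integration.integrable_add[rotated])
    have "(\<lambda>t. indicator {0<..} t *\<^sub>R (exp (- p * t) * deriv h t)) \<in> borel_measurable borel"
      by (intro borel_measurable_continuous_on_indicator continuous_intros cont) auto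
    moreover have "norm (indicator {0<..} t *\<^sub>R (exp (- p * t) * deriv h t)) \<le> norm (w t)" for t
    proof (cases "0 < t")
      case True
      have "exp (- p * t) * deriv h t \<le> w t"
      proof (cases "t < 1")
        case True
        have "exp (- p * t) * deriv h t \<le> 1 * deriv h t"
          using p \<open>0 < t\<close> nonneg[of t] by (intro mult_right_mono) auto
        then show ?thesis using True \<open>0 < t\<close> nonneg[of 1] by (simp add: w_def add_increasing2)
      next
        case False
        then have "deriv h t \<le> deriv h 1"
          using completely_monotone_antimono[OF cm, of 1 t] by simp
        then show ?thesis using False \<open>0 < t\<close> by (simp add: w_def mult.commute mult_left_mono)
      qed
      moreover have "0 \<le> exp (- p * t) * deriv h t" using nonneg[OF True] by simp
      ultimately show ?thesis using True by simp
    qed (simp add: w_def)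
    ultimately show ?thesis
      unfolding laplace_exists_def set_integrable_def
      by (intro Bochner_Integration.integrable_bound[OF w]) auto
  qed
  define F where "F t = exp (- p * t) * h t" for t
  define F' where "F' t = exp (- p * t) * deriv h t - p * (exp (- p * t) * h t)" for t
  have ev: "einterval 0 \<infinity> = {0::real<..}" by (auto simp: einterval_def)
  note ex_h = bernstein_laplace_exists[OF h p]
  have int: "set_integrable lborel {0<..} F'"
    using ex ex_h unfolding F'_def[abs_def] laplace_exists_def
    by (intro set_integral_diff set_integrable_mult_right)
  have F_lim: "(F \<longlongrightarrow> 0) at_top"
  proof (rule tendsto_sandwich[OF _ _ tendsto_const])
    define C where "C = h 1 + deriv h 1 / (p / 2)"
    have "F t \<le> C * exp (- (p / 2) * t)" if "0 < t" for t
    proof -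
      have "F t \<le> exp (- p * t) * (C * exp (p / 2 * t))"
        unfolding F_def C_def using p that by (intro mult_left_mono bernstein_le_exp[OF h]) auto
      also have "\<dots> = C * exp (- (p / 2) * t)" by (simp flip: exp_add)
      finally show ?thesis .
    qed
    then show "\<forall>\<^sub>F t in at_top. F t \<le> C * exp (- (p / 2) * t)"
      by (intro eventually_mono[OF eventually_gt_at_top[of 0]])
    show "\<forall>\<^sub>F t in at_top. 0 \<le> F t"
      by (rule eventually_mono[OF eventually_gt_at_top[of 0]]) (simp add: F_def bernstein_nonneg[OF h])
    show "((\<lambda>t. C * exp (- (p / 2) * t)) \<longlongrightarrow> 0) at_top"
      using p by (intro tendsto_mult_right_zero exp_neg_mult_tendsto_0) auto
  qed
  have "(LBINT t=0..\<infinity>. F' t) = 0 - h 0"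
  proof (rule interval_integral_FTC_integrable)
    show "(F has_vector_derivative F' t) (at t)" if "0 < ereal t" for t
      unfolding has_real_derivative_iff_has_vector_derivative[symmetric] F_def F'_def
      using bernstein_has_real_derivative[OF h, of t] that by (auto intro!: derivative_eq_intros)
    show "isCont F' t" if "0 < ereal t" for t
      unfolding F'_def using isCont[of t] isCont_h[of t] that by (intro continuous_intros) auto
    have "(F \<longlongrightarrow> exp (- p * 0) * h 0) (at_right 0)"
      unfolding F_def by (intro tendsto_intros h0)
    then show "((F \<circ> real_of_ereal) \<longlongrightarrow> h 0) (at_right 0)"
      unfolding zero_ereal_def ereal_tendsto_simps by simp
    show "((F \<circ> real_of_ereal) \<longlongrightarrow> 0) (at_left \<infinity>)"
      unfolding ereal_tendsto_simps by (rule F_lim)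
  qed (use int in \<open>auto simp: ev\<close>)
  moreover have "(LBINT t=0..\<infinity>. F' t) = (LINT t:{0<..}|lborel. F' t)"
    by (simp add: interval_lebesgue_integral_def ev)
  moreover have "\<dots> = laplace (deriv h) p - p * laplace h p"
    using ex ex_h unfolding F'_def laplace_exists_def laplace_def
    by (simp add: set_integral_diff)
  ultimately show "laplace (deriv h) p = p * laplace h p - h 0" by simp
qed

section \<open>The associated function of a Bernstein function\<close>

theorem theorem2:
  fixes h :: "real \<Rightarrow> real"
  assumes "bernstein h" and "\<exists>t\<ge>0. h t \<noteq> 0"
  shows "\<exists>(f\<^sub>0 :: real \<Rightarrow> real) (b :: real).
    licm f\<^sub>0 \<and> b \<ge> 0 \<and>
    (\<forall>p>0. laplace_exists h p \<and> laplace_exists f\<^sub>0 p \<and>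
       1 / (p * laplace h p) = p * laplace_conv_op b f\<^sub>0 p) \<and>
    \<comment> \<open>(i)\<close>
    ((bounded (h ` {0..}) \<and> (\<exists>L>0. (h \<longlongrightarrow> L) at_top)) \<or> filterlim h at_top at_top) \<and>
    (bounded (h ` {0..}) \<and> (\<exists>L>0. (h \<longlongrightarrow> L) at_top) \<longrightarrow>
       (\<exists>l. (f\<^sub>0 \<longlongrightarrow> l) at_top \<and> ((\<lambda>t. 1 / h t) \<longlongrightarrow> l) at_top)) \<and>
    (filterlim h at_top at_top \<longrightarrow> (f\<^sub>0 \<longlongrightarrow> 0) at_top) \<and>
    \<comment> \<open>(ii)\<close>
    (h 0 > 0 \<longrightarrow> Bfun f\<^sub>0 (at_right 0) \<and> has_value_at_0 f\<^sub>0 (ereal (1 / h 0)) \<and> b = 0) \<and>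
    (\<not> h 0 > 0 \<longrightarrow> b > 0 \<or> has_value_at_0 f\<^sub>0 \<infinity>) \<and>
    \<comment> \<open>(iii)\<close>
    (h 0 = 0 \<longrightarrow> (\<exists>D::ereal. 0 \<le> D \<and> has_value_at_0 (deriv h) D \<and> ereal b = 1 / D))"
proof -
  note h = assms(1)
  note h_mono = bernstein_mono[OF h] and h_nonneg = bernstein_nonneg[OF h]
    and h_ex = bernstein_laplace_exists[OF h]
  define g where "g = deriv h"
  have g: "completely_monotone g" unfolding g_def by (rule bernstein_deriv_completely_monotone[OF h])
  have g_ex: "laplace_exists g p" and g_laplace: "h 0 + laplace g p = p * laplace h p" if "0 < p" for p
    using bernstein_laplace_deriv[OF h that] by (simp_all add: g_def)
  obtain t0 where t0: "0 < t0" "0 < h t0"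
  proof -
    obtain t where t: "0 \<le> t" "h t \<noteq> 0" using assms(2) by blast
    then have "0 < h t" using h_nonneg[of t] by simp
    also have "\<dots> \<le> h (t + 1)" using t by (intro h_mono) auto
    finally show thesis using that[of "t + 1"] t by simp
  qed
  have H_pos: "0 < p * laplace h p" if p: "0 < p" for p
  proof -
    have "h t0 * ((t0 + 1) - t0) * exp (- p * (t0 + 1)) \<le> laplace h p"
      by (rule laplace_ge[OF h_ex[OF p]]) (use h_nonneg h_mono t0 p in auto)
    moreover have "0 < h t0 * ((t0 + 1) - t0) * exp (- p * (t0 + 1))" using t0 by simp
    ultimately show ?thesis using p by (meson less_le_trans mult_pos_pos)
  qed
  obtain f\<^sub>0 b where f0: "licm f\<^sub>0" and b: "0 \<le> b"
    and fb: "\<forall>p>0. laplace_exists f\<^sub>0 p \<and> 1 / (p * (h 0 + laplace g p)) = b + laplace f\<^sub>0 p"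
  proof -
    have "\<exists>f b. licm f \<and> 0 \<le> b \<and>
        (\<forall>p>0. laplace_exists f p \<and> 1 / (p * (h 0 + laplace g p)) = b + laplace f p)"
      by (rule reciprocal_of_completely_monotone_laplace[OF g]) (use g_ex g_laplace H_pos h_nonneg in auto)
    then show thesis using that by blast
  qed
  have f0_ex: "laplace_exists f\<^sub>0 p" and key: "inverse (p * laplace h p) = p * b + p * laplace f\<^sub>0 p"
    if "0 < p" for p
  proof -
    show "laplace_exists f\<^sub>0 p" using fb that by blast
    have "1 / (p * (h 0 + laplace g p)) = b + laplace f\<^sub>0 p" using fb that by blast
    then have "p * (b + laplace f\<^sub>0 p) = p * (1 / (p * (p * laplace h p)))"
      unfolding g_laplace[OF that] by (rule arg_cong[OF sym])
    also have "\<dots> = inverse (p * laplace h p)" using that by (simp add: inverse_eq_divide)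
    finally show "inverse (p * laplace h p) = p * b + p * laplace f\<^sub>0 p"
      by (simp only: distrib_left)
  qed
  have f0_cm: "completely_monotone f\<^sub>0" using f0 by (simp add: licm_def completely_monotone_def)
  note f0_nonneg = completely_monotone_nonneg[OF f0_cm] and f0_anti = completely_monotone_antimono[OF f0_cm]
    and g_nonneg = completely_monotone_nonneg[OF g] and g_anti = completely_monotone_antimono[OF g]

  define u where "u n = real (Suc n)" for n
  have u: "0 < u n" "1 \<le> u n" for n by (simp_all add: u_def)
  have u_top: "filterlim u at_top sequentially"
    unfolding u_def[abs_def] by (intro filterlim_compose[OF filterlim_real_sequentially] filterlim_Suc)
  have u_inv: "(\<lambda>n. inverse (u n)) \<longlonglongrightarrow> 0"
    by (rule tendsto_inverse_0_at_top[OF u_top])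
  have s_0: "filterlim (\<lambda>n. s / u n) (at_right 0) sequentially" if "0 < s" for s
  proof (rule tendsto_imp_filterlim_at_right)
    show "(\<lambda>n. s / u n) \<longlonglongrightarrow> 0"
      unfolding divide_inverse by (rule tendsto_mult_right_zero[OF u_inv])
    show "\<forall>\<^sub>F n in sequentially. 0 < s / u n"
      using that u by (intro always_eventually allI divide_pos_pos)
  qed
  have s_top: "filterlim (\<lambda>n. s / inverse (u n)) at_top sequentially" if "0 < s" for s
    using that by (simp add: divide_inverse filterlim_tendsto_pos_mult_at_top[OF tendsto_const _ u_top])

  note key_u = key[OF u(1)]
  let ?v = "\<lambda>n. inverse (u n)"
  have v: "0 < ?v n" for n using u by simp
  note key_v = key[OF v]

  \<comment> \<open>Behaviour of \<open>h\<close> and \<open>f\<^sub>0\<close> at infinity, read off along \<open>p = 1 / (n + 1)\<close>;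
    the term \<open>p b\<close> vanishes in the limit.\<close>
  obtain l where l: "(f\<^sub>0 \<longlongrightarrow> l) at_top"
    using antimono_limit_at_top[of f\<^sub>0] f0_anti f0_nonneg by blast
  have f0_v: "(\<lambda>n. ?v n * laplace f\<^sub>0 (?v n)) \<longlonglongrightarrow> l"
  proof (rule laplace_abelian[where w = f\<^sub>0])
    show "(\<lambda>n. f\<^sub>0 (s / ?v n)) \<longlonglongrightarrow> l" if "0 < s" for s
      by (rule filterlim_compose[OF l s_top[OF that]])
    show "\<bar>f\<^sub>0 (s / ?v n)\<bar> \<le> f\<^sub>0 s" if "0 < s" for n s
      using that u[of n] f0_anti[of s "s * u n"] f0_nonneg[of "s * u n"] by (simp add: divide_inverse)
  qed (use u f0_ex in auto)
  have R_v: "(\<lambda>n. inverse (?v n * laplace h (?v n))) \<longlonglongrightarrow> l"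
    unfolding key_v using tendsto_add[OF tendsto_mult_left_zero[OF u_inv, of b] f0_v] by simp
  have dichotomy: "(bounded (h ` {0..}) \<and> (\<exists>L>0. (h \<longlongrightarrow> L) at_top)) \<or> filterlim h at_top at_top"
  proof -
    have "(\<exists>L. (h \<longlongrightarrow> L) at_top \<and> (\<forall>x>0. h x \<le> L)) \<or> filterlim h at_top at_top"
      by (rule mono_limit_at_top) (use h_mono in auto)
    moreover have "bounded (h ` {0..}) \<and> (\<exists>L>0. (h \<longlongrightarrow> L) at_top)"
      if L: "(h \<longlongrightarrow> L) at_top" "\<forall>x>0. h x \<le> L" for L
    proof
      have "norm (h x) \<le> L" if "0 \<le> x" for x
        using h_mono[of x "x + 1"] L(2)[rule_format, of "x + 1"] h_nonneg[of x] that by simp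
      then show "bounded (h ` {0..})" by (auto simp: bounded_iff)
      show "\<exists>L>0. (h \<longlongrightarrow> L) at_top" using L t0 by (auto intro: less_le_trans)
    qed
    ultimately show ?thesis by blast
  qed
  have bounded_case: "((\<lambda>t. 1 / h t) \<longlongrightarrow> l) at_top" if L: "0 < L" "(h \<longlongrightarrow> L) at_top" for L
  proof -
    have h_le: "h x \<le> L" if "0 < x" for x
    proof (rule tendsto_lowerbound[OF L(2)])
      show "\<forall>\<^sub>F y in at_top. h x \<le> h y"
        using h_mono that by (intro eventually_at_top_linorderI[of x]) auto
    qed simp
    have "(\<lambda>n. ?v n * laplace h (?v n)) \<longlonglongrightarrow> L"
    proof (rule laplace_abelian[where w = "\<lambda>_. L"])
      show "(\<lambda>n. h (s / ?v n)) \<longlonglongrightarrow> L" if "0 < s" for s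
        by (rule filterlim_compose[OF L(2) s_top[OF that]])
      show "\<bar>h (s / ?v n)\<bar> \<le> L" if "0 < s" for n s
        using that u[of n] h_le[of "s / ?v n"] h_nonneg[of "s / ?v n"] by simp
    qed (use u h_ex laplace_const in auto)
    then have "(\<lambda>n. inverse (?v n * laplace h (?v n))) \<longlonglongrightarrow> inverse L"
      using L by (intro tendsto_inverse) auto
    then have "l = inverse L" using R_v LIMSEQ_unique by blast
    then show ?thesis using L by (auto simp: divide_inverse intro!: tendsto_inverse)
  qed
  have unbounded_case: "l = 0" if top: "filterlim h at_top at_top"
  proof -
    have "filterlim (\<lambda>n. exp (- 2) * h (1 / ?v n)) at_top sequentially"
      by (rule filterlim_tendsto_pos_mult_at_top[OF tendsto_const])
        (use filterlim_compose[OF top s_top[of 1]] in auto)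
    then have "filterlim (\<lambda>n. ?v n * laplace h (?v n)) at_top sequentially"
    proof (rule filterlim_at_top_mono)
      have "h (1 / ?v n) * exp (- 2) \<le> ?v n * laplace h (?v n)" for n
        by (rule laplace_ge_mono) (use u h_ex h_nonneg h_mono in auto)
      then show "\<forall>\<^sub>F n in sequentially. exp (- 2) * h (1 / ?v n) \<le> ?v n * laplace h (?v n)"
        by (simp add: mult.commute)
    qed
    then show ?thesis using R_v tendsto_inverse_0_at_top LIMSEQ_unique by blast
  qed

  \<comment> \<open>Behaviour of \<open>h\<close> and \<open>f\<^sub>0\<close> at \<open>0\<close>, read off along \<open>p = n + 1\<close>. If \<open>h 0 > 0\<close>, then \<open>p b + p \<cdot> laplace f\<^sub>0 p\<close>
    stays bounded, which forces \<open>b = 0\<close> and keeps \<open>f\<^sub>0\<close> bounded; if \<open>h 0 = 0\<close>, it diverges, which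
    excludes \<open>b = 0\<close> together with a bounded \<open>f\<^sub>0\<close>.\<close>
  have h0_lim: "(h \<longlongrightarrow> h 0) (at_right 0)" by (rule bernstein_tendsto_at_0[OF h])
  have H_u: "(\<lambda>n. u n * laplace h (u n)) \<longlonglongrightarrow> h 0"
  proof (rule laplace_abelian[where w = h])
    show "(\<lambda>n. h (s / u n)) \<longlonglongrightarrow> h 0" if "0 < s" for s
      by (rule filterlim_compose[OF h0_lim s_0[OF that]])
    show "\<bar>h (s / u n)\<bar> \<le> h s" if "0 < s" for n s
    proof -
      have "s / u n \<le> s" using that u[of n] by (simp add: field_simps)
      then show ?thesis using that u[of n] h_mono[of "s / u n" s] h_nonneg[of "s / u n"] by simp
    qed
  qed (use u h_ex in auto)
  have f0_u: "(\<lambda>n. u n * laplace f\<^sub>0 (u n)) \<longlonglongrightarrow> K"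
    if K: "(f\<^sub>0 \<longlongrightarrow> K) (at_right 0)" "\<forall>x>0. f\<^sub>0 x \<le> K" for K
  proof (rule laplace_abelian[where w = "\<lambda>_. K"])
    show "(\<lambda>n. f\<^sub>0 (s / u n)) \<longlonglongrightarrow> K" if "0 < s" for s
      by (rule filterlim_compose[OF K(1) s_0[OF that]])
    show "\<bar>f\<^sub>0 (s / u n)\<bar> \<le> K" if "0 < s" for n s
      using that u[of n] K(2) f0_nonneg[of "s / u n"] by simp
  qed (use u f0_ex laplace_const in auto)
  have f0_limit: "(\<exists>K. (f\<^sub>0 \<longlongrightarrow> K) (at_right 0) \<and> (\<forall>x>0. f\<^sub>0 x \<le> K)) \<or> filterlim f\<^sub>0 at_top (at_right 0)"
    by (rule antimono_limit_at_0[OF f0_anti])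
  have positive_case: "Bfun f\<^sub>0 (at_right 0) \<and> has_value_at_0 f\<^sub>0 (ereal (1 / h 0)) \<and> b = 0" if h0: "0 < h 0"
  proof -
    have R_u: "(\<lambda>n. inverse (u n * laplace h (u n))) \<longlonglongrightarrow> inverse (h 0)"
      using H_u h0 by (intro tendsto_inverse) auto
    have "\<not> filterlim f\<^sub>0 at_top (at_right 0)"
    proof
      assume top: "filterlim f\<^sub>0 at_top (at_right 0)"
      have "filterlim (\<lambda>n. exp (- 1) * f\<^sub>0 (1 / u n)) at_top sequentially"
        by (rule filterlim_tendsto_pos_mult_at_top[OF tendsto_const])
          (use filterlim_compose[OF top s_0[of 1]] in auto)
      then have "filterlim (\<lambda>n. inverse (u n * laplace h (u n))) at_top sequentially"
      proof (rule filterlim_at_top_mono)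
        have "f\<^sub>0 (1 / u n) * exp (- 1) \<le> u n * laplace f\<^sub>0 (u n)" for n
          by (rule laplace_ge_antimono) (use u f0_ex f0_nonneg f0_anti in auto)
        moreover have "u n * laplace f\<^sub>0 (u n) \<le> inverse (u n * laplace h (u n))" for n
          unfolding key_u using u(1)[of n] b by simp
        ultimately show "\<forall>\<^sub>F n in sequentially. exp (- 1) * f\<^sub>0 (1 / u n) \<le> inverse (u n * laplace h (u n))"
          by (intro always_eventually allI) (metis mult.commute order_trans)
      qed
      from filterlim_at_top_imp_at_infinity[OF this] show False
        by (rule not_tendsto_and_filterlim_at_infinity[OF sequentially_bot R_u])
    qed
    then obtain K where K: "(f\<^sub>0 \<longlongrightarrow> K) (at_right 0)" "\<forall>x>0. f\<^sub>0 x \<le> K" using f0_limit by blast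
    have ub: "(\<lambda>n. u n * b) \<longlonglongrightarrow> inverse (h 0) - K"
      using tendsto_diff[OF R_u f0_u[OF K]] unfolding key_u by simp
    have "(\<lambda>n. u n * b * ?v n) \<longlonglongrightarrow> (inverse (h 0) - K) * 0"
      by (intro tendsto_mult ub u_inv)
    moreover have "(\<lambda>n. u n * b * ?v n) = (\<lambda>n. b)" using u by (auto simp: field_simps less_imp_neq[symmetric])
    ultimately have "b = 0" by (simp add: LIMSEQ_const_iff)
    then have "K = 1 / h 0" using ub by (simp add: LIMSEQ_const_iff divide_inverse)
    moreover have "Bfun f\<^sub>0 (at_right 0)"
      by (rule BfunI[of _ K], rule eventually_mono[OF eventually_at_right_less[of 0]])
        (use K(2) f0_nonneg in simp)
    ultimately show ?thesis using K(1) \<open>b = 0\<close> unfolding has_value_at_0_def by (auto intro: tendsto_ereal)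
  qed
  have zero_case: "b > 0 \<or> has_value_at_0 f\<^sub>0 \<infinity>" if "h 0 = 0"
  proof (rule ccontr)
    assume contra: "\<not> (b > 0 \<or> has_value_at_0 f\<^sub>0 \<infinity>)"
    then have "b = 0" "\<not> filterlim f\<^sub>0 at_top (at_right 0)"
      using b by (auto simp: has_value_at_0_def tendsto_PInfty_eq_at_top)
    then obtain K where K: "(f\<^sub>0 \<longlongrightarrow> K) (at_right 0)" "\<forall>x>0. f\<^sub>0 x \<le> K" using f0_limit by blast
    have R_u: "(\<lambda>n. inverse (u n * laplace h (u n))) \<longlonglongrightarrow> K"
      unfolding key_u using f0_u[OF K] \<open>b = 0\<close> by simp
    have "filterlim (\<lambda>n. inverse (u n * laplace h (u n))) at_top sequentially"
      using H_u H_pos u that by (intro filterlim_inverse_at_top) auto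
    from filterlim_at_top_imp_at_infinity[OF this] show False
      by (rule not_tendsto_and_filterlim_at_infinity[OF sequentially_bot R_u])
  qed

  \<comment> \<open>For \<open>h 0 = 0\<close> the identity reads \<open>1 / (p \<cdot> laplace h' p) = b + laplace f\<^sub>0 p\<close>. As \<open>p\<close> tends to
    infinity, the right side tends to \<open>b\<close> and \<open>p \<cdot> laplace h' p\<close> to \<open>h'(0)\<close>.\<close>
  have deriv_case: "\<exists>D::ereal. 0 \<le> D \<and> has_value_at_0 (deriv h) D \<and> ereal b = 1 / D" if h0: "h 0 = 0"
  proof -
    have "(\<lambda>n. laplace (\<lambda>t. exp (- real n * t) * f\<^sub>0 t) 1) \<longlonglongrightarrow> laplace (\<lambda>_. 0) 1"
    proof (rule laplace_dominated_convergence[where w = f\<^sub>0])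
      show "(\<lambda>n. exp (- real n * t) * f\<^sub>0 t) \<longlonglongrightarrow> 0" if "0 < t" for t
        using filterlim_compose[OF exp_neg_mult_tendsto_0[OF that] filterlim_real_sequentially]
        by (intro tendsto_mult_left_zero) (simp add: mult.commute)
      show "\<bar>exp (- real n * t) * f\<^sub>0 t\<bar> \<le> f\<^sub>0 t" if "0 < t" for n t
        using f0_nonneg[OF that] that by (simp add: abs_mult mult_left_le_one_le)
      have eq: "exp (- 1 * t) * (exp (- real n * t) * f\<^sub>0 t) = exp (- u n * t) * f\<^sub>0 t" for n t
        by (simp add: u_def algebra_simps flip: exp_add)
      show "laplace_exists (\<lambda>t. exp (- real n * t) * f\<^sub>0 t) 1" for n
        using f0_ex[OF u(1)[of n]] unfolding laplace_exists_def eq .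
    qed (use f0_ex laplace_const in auto)
    moreover have "laplace (\<lambda>t. exp (- real n * t) * f\<^sub>0 t) 1 = laplace f\<^sub>0 (u n)" for n
    proof -
      have eq: "exp (- 1 * t) * (exp (- real n * t) * f\<^sub>0 t) = exp (- u n * t) * f\<^sub>0 t" for t
        by (simp add: u_def algebra_simps flip: exp_add)
      show ?thesis unfolding laplace_def eq ..
    qed
    ultimately have f0_vanish: "(\<lambda>n. laplace f\<^sub>0 (u n)) \<longlonglongrightarrow> 0" by (simp add: laplace_const)
    have g_u: "inverse (u n * laplace g (u n)) = b + laplace f\<^sub>0 (u n)" for n
      using fb u[of n] h0 by (simp add: inverse_eq_divide)
    have b_lim: "(\<lambda>n. inverse (u n * laplace g (u n))) \<longlonglongrightarrow> b"
      unfolding g_u using tendsto_add[OF tendsto_const f0_vanish] by simp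
    have g_pos: "0 < u n * laplace g (u n)" for n
      using g_laplace[OF u(1)] H_pos[OF u(1)] u[of n] h0 by (metis add_0 mult_pos_pos)
    have "(\<exists>D. (g \<longlongrightarrow> D) (at_right 0) \<and> (\<forall>x>0. g x \<le> D)) \<or> filterlim g at_top (at_right 0)"
      by (rule antimono_limit_at_0[OF g_anti])
    then show ?thesis
    proof (elim disjE exE conjE)
      fix D assume D: "(g \<longlongrightarrow> D) (at_right 0)" "\<forall>x>0. g x \<le> D"
      have D_lim: "(\<lambda>n. u n * laplace g (u n)) \<longlonglongrightarrow> D"
      proof (rule laplace_abelian[where w = "\<lambda>_. D"])
        show "(\<lambda>n. g (s / u n)) \<longlonglongrightarrow> D" if "0 < s" for s
          by (rule filterlim_compose[OF D(1) s_0[OF that]])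
        show "\<bar>g (s / u n)\<bar> \<le> D" if "0 < s" for n s
          using that u[of n] D(2) g_nonneg[of "s / u n"] by simp
      qed (use u g_ex laplace_const in auto)
      have "(\<lambda>n. u n * laplace g (u n) * inverse (u n * laplace g (u n))) \<longlonglongrightarrow> D * b"
        by (intro tendsto_mult D_lim b_lim)
      moreover have "u n * laplace g (u n) * inverse (u n * laplace g (u n)) = 1" for n
        by (rule right_inverse) (use g_pos[of n] in linarith)
      ultimately have "D * b = 1" by (simp add: LIMSEQ_const_iff)
      moreover have "0 \<le> D" using D(2) g_nonneg[of 1] by (metis order_trans zero_less_one)
      moreover have "has_value_at_0 (deriv h) (ereal D)"
        using D(1) unfolding has_value_at_0_def g_def by (rule tendsto_ereal)
      ultimately show ?thesis by (intro exI[of _ "ereal D"]) (auto simp: one_ereal_def field_simps)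
    next
      assume top: "filterlim g at_top (at_right 0)"
      have "filterlim (\<lambda>n. exp (- 1) * g (1 / u n)) at_top sequentially"
        by (rule filterlim_tendsto_pos_mult_at_top[OF tendsto_const])
          (use filterlim_compose[OF top s_0[of 1]] in auto)
      then have "filterlim (\<lambda>n. u n * laplace g (u n)) at_top sequentially"
      proof (rule filterlim_at_top_mono)
        have "g (1 / u n) * exp (- 1) \<le> u n * laplace g (u n)" for n
          by (rule laplace_ge_antimono) (use u g_ex g_nonneg g_anti in auto)
        then show "\<forall>\<^sub>F n in sequentially. exp (- 1) * g (1 / u n) \<le> u n * laplace g (u n)"
          by (simp add: mult.commute)
      qed
      then have "b = 0" using b_lim tendsto_inverse_0_at_top LIMSEQ_unique by blast
      moreover have "has_value_at_0 (deriv h) \<infinity>"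
        using top by (simp add: has_value_at_0_def tendsto_PInfty_eq_at_top g_def)
      ultimately show ?thesis by (intro exI[of _ \<infinity>]) (simp add: zero_ereal_def)
    qed
  qed

  have transform: "laplace_exists h p \<and> laplace_exists f\<^sub>0 p \<and> 1 / (p * laplace h p) = p * laplace_conv_op b f\<^sub>0 p"
    if "0 < p" for p
    using h_ex[OF that] f0_ex[OF that] key[OF that]
    by (simp add: laplace_conv_op_def divide_inverse distrib_left)
  show ?thesis
  proof (intro exI[of _ f\<^sub>0] exI[of _ b] conjI)
    show "\<not> h 0 > 0 \<longrightarrow> b > 0 \<or> has_value_at_0 f\<^sub>0 \<infinity>"
      using zero_case h_nonneg[of 0] by auto
    show "bounded (h ` {0..}) \<and> (\<exists>L>0. (h \<longlongrightarrow> L) at_top) \<longrightarrow>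
        (\<exists>l. (f\<^sub>0 \<longlongrightarrow> l) at_top \<and> ((\<lambda>t. 1 / h t) \<longlongrightarrow> l) at_top)"
      using l bounded_case by blast
  qed (use f0 b transform dichotomy l unbounded_case positive_case deriv_case in blast)+
qed

end
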